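(* There exist constants $c,C>0$ such that for every integer $d\ge 2$ there exist Borel probability measures $\mu_d,\nu_d$ on $\mathbb{R}^d$ (with all expectations below finite) such that: (i) there is a two-layer ReLU network $F:\mathbb{R}^d\to\mathbb{R}$ with path-norm equal to $1$ such that $$\left|\mathbb{E}_{x\sim\mu_d}[F(x)]-\mathbb{E}_{x\sim\nu_d}[F(x)]\right|\ \ge\ \frac{c}{d\log d};$$ (ii) for every $G\in\mathcal{H}$ with $\|G\|_{\mathcal{H}}\le 1$, $$\left|\mathbb{E}_{x\sim\mu_d}[G(x)]-\mathbb{E}_{x\sim\nu_d}[G(x)]\right|\ \le\ C\,d\,\exp\!\left(-\frac{(\sqrt d-1)^2}{16}\right).$$
   Context: $\sigma(x)=\max\{x,0\}$ (ReLU). A two-layer ReLU network is a function $F(x)=\sum_{i=1}^m w_i\,\sigma(\langle\theta_i,x\rangle-b_i)+w_0$ with finite $m$, $\theta_i\in\mathbb{R}^d$, $b_i,w_i,w_0\in\mathbb{R}$; its path-norm (without bias) is $\sum_{i=1}^m|w_i|\,\|\theta_i\|_2$. $\mathcal{H}$ is the reproducing kernel Hilbert space of functions $\mathbb{R}^d\to\mathbb{R}$ with kernel $k(x,y)=\int_{\mathbb{S}^{d-1}\times\mathbb{R}}\sigma(\langle\theta,x\rangle-b)\,\sigma(\langle\theta,y\rangle-b)\,d\tau(\theta,b)$, where $\tau=\mathrm{Unif}(\mathbb{S}^{d-1})\otimes\mathcal{N}(0,1)$. Equivalently, $\mathcal{H}$ consists of the functions $f_h(x)=\int\sigma(\langle\theta,x\rangle-b)\,h(\theta,b)\,d\tau(\theta,b)$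 with $h\in L^2(\tau)$, and $\|f\|_{\mathcal{H}}=\inf\{\|h\|_{L^2(\tau)}: f=f_h\}$. *)

theory Defs
  imports "HOL-Probability.Probability"
begin

text \<open>
  The dimension \<open>d\<close> is quantified inside the main statement (the constants must not depend on it),
  so it cannot be a type. A point of \<open>d\<close>-dimensional Euclidean space is an extensional function on
  \<open>{..<d}\<close>. As the real line is second countable, the product sigma-algebra below is the Borel
  sigma-algebra of that space. The Euclidean norm of \<open>x\<close> is \<open>L2_set x {..<d}\<close>.
\<close>

abbreviation borel_Rd :: "nat \<Rightarrow> (nat \<Rightarrow> real) measure" where
  "borel_Rd d \<equiv> Pi\<^sub>M {..<d} (\<lambda>_. borel)"

abbreviation Rd :: "nat \<Rightarrow> (nat \<Rightarrow> real) set" where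
  "Rd d \<equiv> {..<d} \<rightarrow>\<^sub>E UNIV"

definition inner_Rd :: "nat \<Rightarrow> (nat \<Rightarrow> real) \<Rightarrow> (nat \<Rightarrow> real) \<Rightarrow> real" where
  "inner_Rd d x y = (\<Sum>i<d. x i * y i)"

abbreviation norm_Rd :: "nat \<Rightarrow> (nat \<Rightarrow> real) \<Rightarrow> real" where
  "norm_Rd d x \<equiv> L2_set x {..<d}"

definition relu :: "real \<Rightarrow> real" where
  "relu t = max t 0"

definition relu_network ::
  "nat \<Rightarrow> nat \<Rightarrow> (nat \<Rightarrow> nat \<Rightarrow> real) \<Rightarrow> (nat \<Rightarrow> real) \<Rightarrow> (nat \<Rightarrow> real) \<Rightarrow> real \<Rightarrow> (nat \<Rightarrow> real) \<Rightarrow> real" where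
  "relu_network d m \<theta> b w w0 x = (\<Sum>i<m. w i * relu (inner_Rd d (\<theta> i) x - b i)) + w0"

definition path_norm :: "nat \<Rightarrow> nat \<Rightarrow> (nat \<Rightarrow> nat \<Rightarrow> real) \<Rightarrow> (nat \<Rightarrow> real) \<Rightarrow> real" where
  "path_norm d m \<theta> w = (\<Sum>i<m. \<bar>w i\<bar> * norm_Rd d (\<theta> i))"

text \<open>
  The uniform distribution on the unit sphere, as the normalised cone measure: the mass of \<open>A\<close> is the
  Lebesgue volume of the part of the unit ball lying on the rays through \<open>A\<close>, divided by the volume
  of the ball. It is a measure on the whole space, concentrated on the sphere.
\<close>

definition unit_ball_Rd :: "nat \<Rightarrow> (nat \<Rightarrow> real) set" where
  "unit_ball_Rd d = {x \<in> Rd d. norm_Rd d x \<le> 1}"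

definition normalize_Rd :: "nat \<Rightarrow> (nat \<Rightarrow> real) \<Rightarrow> (nat \<Rightarrow> real)" where
  "normalize_Rd d x = (\<lambda>i\<in>{..<d}. x i / norm_Rd d x)"

definition unif_sphere :: "nat \<Rightarrow> (nat \<Rightarrow> real) measure" where
  "unif_sphere d =
     distr (uniform_measure (Pi\<^sub>M {..<d} (\<lambda>_. lborel)) (unit_ball_Rd d)) (borel_Rd d) (normalize_Rd d)"

definition feature_measure :: "nat \<Rightarrow> ((nat \<Rightarrow> real) \<times> real) measure" where
  "feature_measure d = unif_sphere d \<Otimes>\<^sub>M density lborel std_normal_density"

definition L2_functions :: "'a measure \<Rightarrow> ('a \<Rightarrow> real) set" where
  "L2_functions M = {h \<in> borel_measurable M. integrable M (\<lambda>z. (h z)\<^sup>2)}"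

definition L2_norm :: "'a measure \<Rightarrow> ('a \<Rightarrow> real) \<Rightarrow> real" where
  "L2_norm M h = sqrt (\<integral>z. (h z)\<^sup>2 \<partial>M)"

definition feature_fun :: "nat \<Rightarrow> ((nat \<Rightarrow> real) \<times> real \<Rightarrow> real) \<Rightarrow> (nat \<Rightarrow> real) \<Rightarrow> real" where
  "feature_fun d h x = (\<integral>(\<theta>, b). relu (inner_Rd d \<theta> x - b) * h (\<theta>, b) \<partial>feature_measure d)"

text \<open>
  The reproducing kernel Hilbert space of the kernel
  \<open>k x y = (\<integral>(\<theta>, b). relu (inner_Rd d \<theta> x - b) * relu (inner_Rd d \<theta> y - b) \<partial>feature_measure d)\<close>,
  in its feature-space description. Functions on the space matter only on the carrier \<open>Rd d\<close>.
\<close>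

definition representers ::
  "nat \<Rightarrow> ((nat \<Rightarrow> real) \<Rightarrow> real) \<Rightarrow> ((nat \<Rightarrow> real) \<times> real \<Rightarrow> real) set" where
  "representers d f =
     {h \<in> L2_functions (feature_measure d). \<forall>x\<in>Rd d. f x = feature_fun d h x}"

definition relu_rkhs :: "nat \<Rightarrow> ((nat \<Rightarrow> real) \<Rightarrow> real) set" where
  "relu_rkhs d = {f. representers d f \<noteq> {}}"

definition relu_rkhs_norm :: "nat \<Rightarrow> ((nat \<Rightarrow> real) \<Rightarrow> real) \<Rightarrow> real" where
  "relu_rkhs_norm d f = Inf (L2_norm (feature_measure d) ` representers d f)"

lemma measurable_norm_Rd: "norm_Rd d \<in> borel_measurable (Pi\<^sub>M {..<d} (\<lambda>_. lborel))"
  unfolding L2_set_def by measurable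

lemma unit_ball_Rd_sets: "unit_ball_Rd d \<in> sets (Pi\<^sub>M {..<d} (\<lambda>_. lborel))"
proof -
  have "unit_ball_Rd d = {x \<in> space (Pi\<^sub>M {..<d} (\<lambda>_. lborel)). norm_Rd d x \<le> 1}"
    by (auto simp: unit_ball_Rd_def space_PiM)
  then show ?thesis
    using measurable_norm_Rd[of d] by simp
qed

lemma measurable_normalize_Rd:
  "normalize_Rd d \<in> measurable (Pi\<^sub>M {..<d} (\<lambda>_. lborel)) (borel_Rd d)"
  unfolding normalize_Rd_def
  by (rule measurable_restrict)
    (intro borel_measurable_divide measurable_norm_Rd, simp)

lemma emeasure_box_Rd:
  assumes "a \<ge> 0"
  shows "emeasure (Pi\<^sub>M {..<d} (\<lambda>_. lborel)) ({..<d} \<rightarrow>\<^sub>E {-a..a}) = ennreal ((2 * a) ^ d)"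
proof -
  interpret product_sigma_finite "\<lambda>_::nat. lborel :: real measure" ..
  show ?thesis
    using assms by (subst emeasure_PiM) (auto simp: ennreal_power)
qed

lemma unit_ball_Rd_emeasure:
  "emeasure (Pi\<^sub>M {..<d} (\<lambda>_. lborel)) (unit_ball_Rd d) \<noteq> 0"
  "emeasure (Pi\<^sub>M {..<d} (\<lambda>_. lborel)) (unit_ball_Rd d) \<noteq> \<infinity>"
proof -
  let ?M = "Pi\<^sub>M {..<d} (\<lambda>_. lborel :: real measure)"
  obtain r :: real where r: "r > 0" "real d * r \<le> 1"
    by (rule that[of "1 / real (Suc d)"]) (simp_all add: field_simps)
  have "({..<d} \<rightarrow>\<^sub>E {-r..r}) \<subseteq> unit_ball_Rd d"
  proof
    fix x assume x: "x \<in> ({..<d} \<rightarrow>\<^sub>E {-r..r})"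
    have le: "\<bar>x i\<bar> \<le> r" if "i < d" for i
      using PiE_mem[OF x, of i] that by (simp add: abs_le_iff)
    have "norm_Rd d x \<le> (\<Sum>i<d. \<bar>x i\<bar>)"
      by (rule L2_set_le_sum_abs)
    also have "\<dots> \<le> (\<Sum>i<d. r)"
      by (intro sum_mono le) simp
    also have "\<dots> \<le> 1" using r by simp
    finally show "x \<in> unit_ball_Rd d"
      using x by (simp add: unit_ball_Rd_def PiE_iff)
  qed
  then have "emeasure ?M ({..<d} \<rightarrow>\<^sub>E {-r..r}) \<le> emeasure ?M (unit_ball_Rd d)"
    by (intro emeasure_mono unit_ball_Rd_sets)
  moreover have "emeasure ?M ({..<d} \<rightarrow>\<^sub>E {-r..r}) > 0"
    using r by (simp add: emeasure_box_Rd)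
  ultimately show "emeasure ?M (unit_ball_Rd d) \<noteq> 0" by auto
  have "unit_ball_Rd d \<subseteq> ({..<d} \<rightarrow>\<^sub>E {-1..1})"
  proof
    fix x assume x: "x \<in> unit_ball_Rd d"
    have "x i \<in> {-1..1}" if "i < d" for i
    proof -
      have "\<bar>x i\<bar> \<le> L2_set (\<lambda>i. \<bar>x i\<bar>) {..<d}"
        using that by (intro member_le_L2_set) auto
      also have "\<dots> = norm_Rd d x" by (simp add: L2_set_def)
      also have "\<dots> \<le> 1" using x by (simp add: unit_ball_Rd_def)
      finally show ?thesis by (simp add: abs_le_iff)
    qed
    then show "x \<in> ({..<d} \<rightarrow>\<^sub>E {-1..1})"
      using x by (simp add: unit_ball_Rd_def PiE_iff)
  qed
  then have "emeasure ?M (unit_ball_Rd d) \<le> emeasure ?M ({..<d} \<rightarrow>\<^sub>E {-1..1})"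
    by (intro emeasure_mono sets_PiM_I_finite) simp_all
  also have "\<dots> < \<infinity>"
    unfolding emeasure_box_Rd[OF zero_le_one] by simp
  finally show "emeasure ?M (unit_ball_Rd d) \<noteq> \<infinity>" by simp
qed

lemma measurable_normalize_uniform:
  "normalize_Rd d \<in>
     measurable (uniform_measure (Pi\<^sub>M {..<d} (\<lambda>_. lborel)) (unit_ball_Rd d)) (borel_Rd d)"
  using measurable_normalize_Rd[of d]
  by (subst measurable_cong_sets[OF sets_uniform_measure refl])

lemma prob_space_unif_sphere: "prob_space (unif_sphere d)"
  unfolding unif_sphere_def
  by (intro prob_space.prob_space_distr prob_space_uniform_measure unit_ball_Rd_emeasure
      measurable_normalize_uniform)

lemma prob_space_feature_measure: "prob_space (feature_measure d)"
proof -
  interpret A: prob_space "unif_sphere d" by (rule prob_space_unif_sphere)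
  interpret B: prob_space "density lborel std_normal_density"
    by (rule prob_space_normal_density) simp
  interpret pair_prob_space "unif_sphere d" "density lborel std_normal_density" ..
  show ?thesis unfolding feature_measure_def by (rule prob_space_axioms)
qed

lemma AE_unif_sphere:
  assumes "d > 0"
  shows "AE \<theta> in unif_sphere d. norm_Rd d \<theta> = 1"
proof -
  let ?M = "Pi\<^sub>M {..<d} (\<lambda>_. lborel :: real measure)"
  let ?U = "uniform_measure ?M (unit_ball_Rd d)"
  have "emeasure ?M ({..<d} \<rightarrow>\<^sub>E {0}) = 0"
    using emeasure_box_Rd[of 0 d] assms by simp
  moreover have "({..<d} \<rightarrow>\<^sub>E {0}) \<in> sets ?M"
    by (rule sets_PiM_I_finite) simp_all
  ultimately have "AE x in ?M. x \<notin> ({..<d} \<rightarrow>\<^sub>E {0})"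
    by (intro AE_not_in null_setsI)
  then have "AE x in ?M. x \<in> unit_ball_Rd d \<longrightarrow> norm_Rd d (normalize_Rd d x) = 1"
  proof eventually_elim
    case (elim x)
    show ?case
    proof
      assume "x \<in> unit_ball_Rd d"
      with elim have "norm_Rd d x \<noteq> 0"
        by (auto simp: L2_set_eq_0_iff unit_ball_Rd_def PiE_iff fun_eq_iff extensional_def split: if_splits)
      then have pos: "norm_Rd d x > 0"
        by (simp add: less_le)
      have "norm_Rd d (normalize_Rd d x) = L2_set (\<lambda>i. inverse (norm_Rd d x) * x i) {..<d}"
        by (intro L2_set_cong) (auto simp: normalize_Rd_def divide_inverse)
      also have "\<dots> = inverse (norm_Rd d x) * norm_Rd d x"
        using pos by (subst L2_set_right_distrib) auto
      finally show "norm_Rd d (normalize_Rd d x) = 1" using pos by simp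
    qed
  qed
  then have "AE x in ?U. norm_Rd d (normalize_Rd d x) = 1"
    by (intro AE_uniform_measureI unit_ball_Rd_sets)
  then show ?thesis
    unfolding unif_sphere_def L2_set_def
    by (subst AE_distr_iff[OF measurable_normalize_uniform]) simp_all
qed

end

theory Submission
  imports Defs
begin

text \<open>
  Let \<open>\<nu>\<close> be the standard Gaussian on \<open>Rd d\<close> and give \<open>\<mu>\<close> the density \<open>1 + sin (w * x 0)\<close> with respect to \<open>\<nu>\<close>,
  where \<open>w = sqrt d\<close>. A unit vector \<open>\<theta>\<close> sees the oscillation only through the Gaussian variable
  \<open>inner_Rd d \<theta> x\<close>; conditioning on it leaves an independent Gaussian part of \<open>x 0\<close> of variance
  \<open>1 - (\<theta> 0)\<^sup>2\<close>, which damps \<open>sin (w * x 0)\<close> by the factor \<open>exp (- d * (1 - (\<theta> 0)\<^sup>2) / 2)\<close>. On the sphere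
  \<open>(\<theta> 0)\<^sup>2 \<le> 1 / 2\<close> up to probability \<open>2 * 2 powr (- d / 2)\<close>, so in \<open>L2\<close> of the feature measure the
  discrepancy of a single ReLU is exponentially small. In the direction \<open>\<theta> = (1, 0, ..., 0)\<close> there is no
  damping, and a hat function supported on one positive half wave of \<open>sin (w * x 0)\<close>, a combination of three
  ReLUs, has discrepancy of order \<open>1 / w\<^sup>2 = 1 / d\<close>.
\<close>

section \<open>Smoothing of an oscillation by a Gaussian\<close>

lemma abs_relu_le: "\<bar>relu t\<bar> \<le> \<bar>t\<bar>"
  by (simp add: relu_def)

lemma borel_measurable_relu [measurable]: "relu \<in> borel_measurable borel"
  unfolding relu_def[abs_def] by measurable

text \<open>Real and imaginary part of the characteristic function of the standard normal
  distribution.\<close>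

lemma integral_std_normal_cos_sin:
  fixes t :: real
  shows "(\<integral>x. std_normal_density x * cos (t * x) \<partial>lborel) = exp (- t\<^sup>2 / 2)"
    and "(\<integral>x. std_normal_density x * sin (t * x) \<partial>lborel) = 0"
proof -
  interpret real_distribution std_normal_distribution by (rule real_dist_normal_dist)
  have int: "integrable std_normal_distribution (\<lambda>x. iexp (t * x))"
    by (rule integrable_iexp) auto
  have char: "(CLINT x|std_normal_distribution. iexp (t * x)) = complex_of_real (exp (- t\<^sup>2 / 2))"
    using char_std_normal_distribution by (simp add: char_def fun_eq_iff)
  have "exp (- t\<^sup>2 / 2) = Re (CLINT x|std_normal_distribution. iexp (t * x))"
    unfolding char by simp
  also have "\<dots> = (\<integral>x. cos (t * x) \<partial>std_normal_distribution)"
    by (subst integral_Re[OF int, symmetric]) (simp add: Re_exp)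
  also have "\<dots> = (\<integral>x. std_normal_density x * cos (t * x) \<partial>lborel)"
    by (subst integral_density) auto
  finally show "(\<integral>x. std_normal_density x * cos (t * x) \<partial>lborel) = exp (- t\<^sup>2 / 2)" ..
  have "0 = Im (CLINT x|std_normal_distribution. iexp (t * x))"
    unfolding char by simp
  also have "\<dots> = (\<integral>x. sin (t * x) \<partial>std_normal_distribution)"
    by (subst integral_Im[OF int, symmetric]) (simp add: Im_exp)
  also have "\<dots> = (\<integral>x. std_normal_density x * sin (t * x) \<partial>lborel)"
    by (subst integral_density) auto
  finally show "(\<integral>x. std_normal_density x * sin (t * x) \<partial>lborel) = 0" ..
qed

lemma integrable_mult_bounded:
  fixes f g :: "'a \<Rightarrow> real"
  assumes "integrable M f" "g \<in> borel_measurable M" "\<And>x. \<bar>g x\<bar> \<le> 1"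
  shows "integrable M (\<lambda>x. f x * g x)"
  by (rule Bochner_Integration.integrable_bound[OF assms(1)])
     (use assms in \<open>auto simp: abs_mult intro!: mult_left_le\<close>)

text \<open>After the substitution \<open>x = m + v * z\<close> the addition formula splits the
  sine. The part odd in \<open>z\<close> integrates to zero, and the even part is the characteristic
  function at \<open>w * v\<close>. This factor is the source of all the exponential
  smallness.\<close>

lemma integral_normal_density_sin:
  fixes w m v :: real
  assumes v: "v > 0"
  shows "(\<integral>x. normal_density m v x * sin (w * x) \<partial>lborel) = exp (- (w * v)\<^sup>2 / 2) * sin (w * m)"
proof -
  have nd: "v * normal_density m v (m + v * z) = std_normal_density z" for z
    using v by (simp add: normal_density_def real_sqrt_mult power_mult_distrib)
  have i: "integrable lborel (\<lambda>z. std_normal_density z * cos (w * v * z))"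
      "integrable lborel (\<lambda>z. std_normal_density z * sin (w * v * z))"
    by (intro integrable_mult_bounded; simp)+
  have "(\<integral>x. normal_density m v x * sin (w * x) \<partial>lborel)
      = v * (\<integral>z. normal_density m v (m + v * z) * sin (w * (m + v * z)) \<partial>lborel)"
    using v by (subst lborel_integral_real_affine[of v _ m]) auto
  also have "\<dots> = (\<integral>z. (v * normal_density m v (m + v * z)) * sin (w * (m + v * z)) \<partial>lborel)"
    by (simp add: mult.assoc)
  also have "\<dots> = (\<integral>z. sin (w * m) * (std_normal_density z * cos (w * v * z))
                      + cos (w * m) * (std_normal_density z * sin (w * v * z)) \<partial>lborel)"
    unfolding nd by (intro Bochner_Integration.integral_cong refl)
      (simp add: distrib_left sin_add algebra_simps)
  also have "\<dots> = exp (- (w * v)\<^sup>2 / 2) * sin (w * m)"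
    using i integral_std_normal_cos_sin[of "w * v"] by simp
  finally show ?thesis .
qed

lemma integrable_normal_abs: "v > 0 \<Longrightarrow> integrable lborel (\<lambda>x. normal_density 0 v x * \<bar>x\<bar>)"
  using integrable_normal_moment_abs[of v 0 1] by simp

text \<open>Two factorisations of the joint density of \<open>x\<close> and
  \<open>t = u * x + y\<close>, where \<open>x\<close> is standard normal and \<open>y\<close> is an
  independent normal of deviation \<open>v\<close>. On the left stands the law of \<open>x\<close>
  times the law of \<open>t\<close> given \<open>x\<close>. On the right stands the law of
  \<open>t\<close>, of variance \<open>u\<^sup>2 + v\<^sup>2 = 1\<close>, times the law of
  \<open>x\<close> given \<open>t\<close>, which has mean \<open>u * t\<close> and deviation
  \<open>v\<close>.\<close>

lemma normal_density_rotate: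
  fixes u v :: real
  assumes v: "v > 0" and uv: "u\<^sup>2 + v\<^sup>2 = 1"
  shows "std_normal_density x * normal_density 0 v (t - u * x) = std_normal_density t * normal_density (u * t) v x"
proof -
  have "- x\<^sup>2 / 2 - (t - u * x)\<^sup>2 / (2 * v\<^sup>2) = - t\<^sup>2 / 2 - (x - u * t)\<^sup>2 / (2 * v\<^sup>2)"
  proof -
    have "x\<^sup>2 * v\<^sup>2 + (t - u * x)\<^sup>2 = t\<^sup>2 * v\<^sup>2 + (x - u * t)\<^sup>2"
      using uv by algebra
    then show ?thesis using v by (simp add: field_simps)
  qed
  then have "exp (- x\<^sup>2 / 2) * exp (- (t - u * x)\<^sup>2 / (2 * v\<^sup>2)) = exp (- t\<^sup>2 / 2) * exp (- (x - u * t)\<^sup>2 / (2 * v\<^sup>2))"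
    by (simp add: exp_add[symmetric] diff_divide_distrib)
  then show ?thesis
    by (simp add: normal_density_def)
qed

lemma integral_std_normal_abs_le: "(\<integral>x. std_normal_density x * \<bar>x\<bar> \<partial>lborel) \<le> 1"
proof -
  have "sqrt (2 / pi) \<le> sqrt 1" using pi_ge_two by (intro real_sqrt_le_mono) simp
  then show ?thesis using integral_std_normal_moment_abs_odd[of 0] by simp
qed

text \<open>In the coordinates \<open>t = u * x + y\<close> and \<open>x\<close> the ReLU depends on
  \<open>t\<close> alone, so integrating over \<open>x\<close> first leaves a sine against a normal
  density of deviation \<open>v\<close>, which is damped. What remains is an integral over
  \<open>t\<close>, bounded by the first absolute moment of the Gaussian plus
  \<open>\<bar>b\<bar>\<close>.\<close>

lemma oscillation_smoothing:
  fixes w u v b :: real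
  assumes v: "v > 0" and uv: "u\<^sup>2 + v\<^sup>2 = 1"
  defines "F \<equiv> \<lambda>x y. std_normal_density x * normal_density 0 v y * (sin (w * x) * relu (u * x + y - b))"
  shows "\<bar>\<integral>y. (\<integral>x. F x y \<partial>lborel) \<partial>lborel\<bar> \<le> exp (- (w * v)\<^sup>2 / 2) * (1 + \<bar>b\<bar>)"
proof -
  let ?n = "normal_density 0 v" and ?p = std_normal_density
  \<comment> \<open>The dominating function is a sum of products of a function of \<open>x\<close>
    and a function of \<open>y\<close>, each with a finite first moment.\<close>
  have intF: "integrable (lborel \<Otimes>\<^sub>M lborel) (case_prod F)"
  proof (rule Bochner_Integration.integrable_bound)
    have *: "integrable (lborel \<Otimes>\<^sub>M lborel) (\<lambda>(x, y). f x * g y)"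
      if "integrable lborel f" "integrable lborel g" for f g :: "real \<Rightarrow> real"
      using that by (intro lborel_pair.Fubini_integrable) (auto simp: abs_mult split_beta')
    show "integrable (lborel \<Otimes>\<^sub>M lborel) (\<lambda>(x, y). \<bar>u\<bar> * ((?p x * \<bar>x\<bar>) * ?n y) + (?p x * (?n y * \<bar>y\<bar>)) + \<bar>b\<bar> * (?p x * ?n y))"
      using *[of "\<lambda>x. ?p x * \<bar>x\<bar>" ?n] *[of ?p "\<lambda>x. ?n x * \<bar>x\<bar>"] *[of ?p ?n] integrable_normal_abs[OF v] integrable_normal_abs[of 1] v
      by (simp add: split_beta')
    show "case_prod F \<in> borel_measurable (lborel \<Otimes>\<^sub>M lborel)"
      unfolding F_def by measurable
    have "\<bar>F x y\<bar> \<le> \<bar>u\<bar> * ((?p x * \<bar>x\<bar>) * ?n y) + (?p x * (?n y * \<bar>y\<bar>)) + \<bar>b\<bar> * (?p x * ?n y)" for x y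
    proof -
      have "\<bar>relu (u * x + y - b)\<bar> \<le> \<bar>u\<bar> * \<bar>x\<bar> + \<bar>y\<bar> + \<bar>b\<bar>"
        using abs_relu_le[of "u * x + y - b"] by (simp add: abs_mult[symmetric])
      then have "\<bar>sin (w * x)\<bar> * \<bar>relu (u * x + y - b)\<bar> \<le> 1 * (\<bar>u\<bar> * \<bar>x\<bar> + \<bar>y\<bar> + \<bar>b\<bar>)"
        by (intro mult_mono) auto
      then have "(?p x * ?n y) * (\<bar>sin (w * x)\<bar> * \<bar>relu (u * x + y - b)\<bar>) \<le> (?p x * ?n y) * (\<bar>u\<bar> * \<bar>x\<bar> + \<bar>y\<bar> + \<bar>b\<bar>)"
        by (intro mult_left_mono) (auto simp: normal_density_nonneg)
      then show ?thesis by (simp add: F_def abs_mult normal_density_nonneg algebra_simps)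
    qed
    then show "AE z in lborel \<Otimes>\<^sub>M lborel. norm (case_prod F z) \<le> norm (case z of (x, y) \<Rightarrow> \<bar>u\<bar> * ((?p x * \<bar>x\<bar>) * ?n y) + (?p x * (?n y * \<bar>y\<bar>)) + \<bar>b\<bar> * (?p x * ?n y))"
      by (intro always_eventually) (auto intro: order_trans[OF _ abs_ge_self])
  qed
  \<comment> \<open>The integrand in the new coordinates. For fixed \<open>x\<close> the passage
    from \<open>y\<close> to \<open>t\<close> is a translation, so no Jacobian appears.\<close>
  define H where "H = (\<lambda>t x. (?p t * relu (t - b)) * (normal_density (u * t) v x * sin (w * x)))"
  have FH: "F x (t - u * x) = H t x" for x t
    using normal_density_rotate[OF v uv, of x t] by (simp add: F_def H_def mult_ac)
  have relu_int: "integrable lborel (\<lambda>t. ?p t * relu (t - b))"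
  proof (rule Bochner_Integration.integrable_bound)
    show "integrable lborel (\<lambda>t. ?p t * \<bar>t\<bar> + \<bar>b\<bar> * ?p t)"
      using integrable_normal_abs[of 1] by simp
    show "AE t in lborel. norm (?p t * relu (t - b)) \<le> norm (?p t * \<bar>t\<bar> + \<bar>b\<bar> * ?p t)"
    proof (intro always_eventually allI)
      fix t
      have "\<bar>relu (t - b)\<bar> \<le> \<bar>t\<bar> + \<bar>b\<bar>" using abs_relu_le[of "t - b"] by simp
      then have "?p t * \<bar>relu (t - b)\<bar> \<le> ?p t * (\<bar>t\<bar> + \<bar>b\<bar>)" by (intro mult_left_mono) auto
      then show "norm (?p t * relu (t - b)) \<le> norm (?p t * \<bar>t\<bar> + \<bar>b\<bar> * ?p t)"
        by (simp add: abs_mult algebra_simps)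
    qed
  qed measurable
  have intnd: "integrable lborel (\<lambda>x. normal_density m v x * sin (w * x))" for m
    using v by (intro integrable_mult_bounded) auto
  \<comment> \<open>For every \<open>t\<close> the normal density in \<open>x\<close> has mass one,
    so the integral of \<open>\<bar>H t x\<bar>\<close> over \<open>x\<close> is at most the factor
    that depends on \<open>t\<close>.\<close>
  have intH: "integrable (lborel \<Otimes>\<^sub>M lborel) (case_prod H)"
  proof (rule lborel_pair.Fubini_integrable)
    show "case_prod H \<in> borel_measurable (lborel \<Otimes>\<^sub>M lborel)"
      unfolding H_def normal_density_def by measurable
    show "AE t in lborel. integrable lborel (\<lambda>x. case_prod H (t, x))"
      unfolding H_def using intnd by simp
    show "integrable lborel (\<lambda>t. \<integral>x. norm (case_prod H (t, x)) \<partial>lborel)"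
    proof (rule Bochner_Integration.integrable_bound[OF relu_int])
      show "(\<lambda>t. \<integral>x. norm (case_prod H (t, x)) \<partial>lborel) \<in> borel_measurable lborel"
        unfolding H_def normal_density_def by measurable
      have "(\<integral>x. normal_density (u * t) v x * \<bar>sin (w * x)\<bar> \<partial>lborel) \<le> (\<integral>x. normal_density (u * t) v x \<partial>lborel)" for t
        using v by (intro integral_mono integrable_mult_bounded)
          (auto simp: normal_density_nonneg intro!: mult_left_le)
      then have "(\<integral>x. normal_density (u * t) v x * \<bar>sin (w * x)\<bar> \<partial>lborel) \<le> 1" for t
        using v by simp
      then have "(?p t * \<bar>relu (t - b)\<bar>) * (\<integral>x. normal_density (u * t) v x * \<bar>sin (w * x)\<bar> \<partial>lborel) \<le> (?p t * \<bar>relu (t - b)\<bar>) * 1" for t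
        by (intro mult_left_mono) auto
      then show "AE t in lborel. norm (\<integral>x. norm (case_prod H (t, x)) \<partial>lborel) \<le> norm (?p t * relu (t - b))"
        by (intro always_eventually) (simp add: H_def abs_mult normal_density_nonneg)
    qed
  qed
  have "(\<integral>y. (\<integral>x. F x y \<partial>lborel) \<partial>lborel) = (\<integral>x. (\<integral>y. F x y \<partial>lborel) \<partial>lborel)"
    by (rule lborel_pair.Fubini_integral[OF intF])
  also have "\<dots> = (\<integral>x. (\<integral>t. H t x \<partial>lborel) \<partial>lborel)"
    using lborel_integral_real_affine[of 1 "F x" "- (u * x)" for x]
    by (simp add: FH[symmetric] algebra_simps)
  also have "\<dots> = (\<integral>t. (\<integral>x. H t x \<partial>lborel) \<partial>lborel)"
    by (rule lborel_pair.Fubini_integral[OF intH])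
  also have "\<dots> = exp (- (w * v)\<^sup>2 / 2) * (\<integral>t. ?p t * relu (t - b) * sin (w * (u * t)) \<partial>lborel)"
  proof -
    have "(\<integral>x. H t x \<partial>lborel) = exp (- (w * v)\<^sup>2 / 2) * (?p t * relu (t - b) * sin (w * (u * t)))" for t
      unfolding H_def by (simp add: integral_normal_density_sin[OF v])
    then show ?thesis by simp
  qed
  finally have eq: "(\<integral>y. (\<integral>x. F x y \<partial>lborel) \<partial>lborel)
      = exp (- (w * v)\<^sup>2 / 2) * (\<integral>t. ?p t * relu (t - b) * sin (w * (u * t)) \<partial>lborel)" .
  have "\<bar>\<integral>t. ?p t * relu (t - b) * sin (w * (u * t)) \<partial>lborel\<bar>
      \<le> (\<integral>t. \<bar>?p t * relu (t - b) * sin (w * (u * t))\<bar> \<partial>lborel)"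
    by (rule integral_abs_bound)
  also have "\<dots> \<le> (\<integral>t. ?p t * \<bar>t\<bar> + \<bar>b\<bar> * ?p t \<partial>lborel)"
  proof (rule integral_mono)
    show "integrable lborel (\<lambda>t. \<bar>?p t * relu (t - b) * sin (w * (u * t))\<bar>)"
      by (intro integrable_abs integrable_mult_bounded relu_int) auto
    show "integrable lborel (\<lambda>t. ?p t * \<bar>t\<bar> + \<bar>b\<bar> * ?p t)"
      using integrable_normal_abs[of 1] by simp
    fix t
    have "\<bar>relu (t - b)\<bar> \<le> \<bar>t\<bar> + \<bar>b\<bar>" using abs_relu_le[of "t - b"] by simp
    then have "\<bar>relu (t - b)\<bar> * \<bar>sin (w * (u * t))\<bar> \<le> (\<bar>t\<bar> + \<bar>b\<bar>) * 1" by (intro mult_mono) auto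
    then have "?p t * (\<bar>relu (t - b)\<bar> * \<bar>sin (w * (u * t))\<bar>) \<le> ?p t * (\<bar>t\<bar> + \<bar>b\<bar>)" by (intro mult_left_mono) auto
    then show "\<bar>?p t * relu (t - b) * sin (w * (u * t))\<bar> \<le> ?p t * \<bar>t\<bar> + \<bar>b\<bar> * ?p t"
      by (simp add: abs_mult algebra_simps)
  qed
  also have "\<dots> \<le> 1 + \<bar>b\<bar>"
    using integrable_normal_abs[of 1] integral_std_normal_abs_le by simp
  finally show ?thesis
    unfolding eq by (simp add: abs_mult)
qed

section \<open>The two measures\<close>

text \<open>The perturbation is bounded by 1, which keeps the density nonnegative, and odd, which
  keeps the total mass at 1. No normalising constant is required.\<close>

definition oscillating_normal :: "real \<Rightarrow> real measure" where
  "oscillating_normal w = density lborel (\<lambda>x. ennreal (std_normal_density x * (1 + sin (w * x))))"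

lemma sets_oscillating_normal [simp, measurable_cong]: "sets (oscillating_normal w) = sets borel"
  by (simp add: oscillating_normal_def)

lemma space_oscillating_normal [simp]: "space (oscillating_normal w) = UNIV"
  by (simp add: oscillating_normal_def)

lemma one_plus_sin_nonneg: "0 \<le> 1 + sin (x::real)"
  using sin_ge_minus_one[of x] by linarith

text \<open>The density is the Gaussian plus the Gaussian times the sine. Both terms are integrable
  against \<open>f\<close>, and the first one cancels in the difference.\<close>

lemma oscillating_normal_integral:
  fixes f :: "real \<Rightarrow> real"
  assumes f: "integrable std_normal_distribution f"
  shows "integrable (oscillating_normal w) f"
    and "(\<integral>x. f x \<partial>oscillating_normal w) - (\<integral>x. f x \<partial>std_normal_distribution)
       = (\<integral>x. std_normal_density x * (sin (w * x) * f x) \<partial>lborel)"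
proof -
  have [measurable]: "f \<in> borel_measurable borel"
    using borel_measurable_integrable[OF f] by simp
  have i1: "integrable lborel (\<lambda>x. std_normal_density x * f x)"
    using f by (simp add: integrable_density)
  have i2: "integrable lborel (\<lambda>x. std_normal_density x * (sin (w * x) * f x))"
    using integrable_mult_bounded[OF i1, of "\<lambda>x. sin (w * x)"] by (simp add: mult_ac)
  have nn: "0 \<le> std_normal_density x * (1 + sin (w * x))" for x
    by (intro mult_nonneg_nonneg one_plus_sin_nonneg) simp
  have split: "std_normal_density x * (1 + sin (w * x)) * f x
      = std_normal_density x * f x + std_normal_density x * (sin (w * x) * f x)" for x
    by (simp add: algebra_simps)
  show "integrable (oscillating_normal w) f"
    unfolding oscillating_normal_def using i1 i2 nn
    by (subst integrable_density) (auto simp: split)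
  have "(\<integral>x. f x \<partial>oscillating_normal w) = (\<integral>x. std_normal_density x * (1 + sin (w * x)) * f x \<partial>lborel)"
    unfolding oscillating_normal_def using nn by (subst integral_density) auto
  also have "\<dots> = (\<integral>x. std_normal_density x * f x \<partial>lborel) + (\<integral>x. std_normal_density x * (sin (w * x) * f x) \<partial>lborel)"
    unfolding split using i1 i2 by simp
  also have "(\<integral>x. std_normal_density x * f x \<partial>lborel) = (\<integral>x. f x \<partial>std_normal_distribution)"
    by (subst integral_density) auto
  finally show "(\<integral>x. f x \<partial>oscillating_normal w) - (\<integral>x. f x \<partial>std_normal_distribution)
       = (\<integral>x. std_normal_density x * (sin (w * x) * f x) \<partial>lborel)" by simp
qed

lemma prob_space_std_normal: "prob_space std_normal_distribution"
  by (rule prob_space_normal_density) simp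

lemma prob_space_oscillating_normal: "prob_space (oscillating_normal w)"
proof
  have nn: "0 \<le> std_normal_density x * (1 + sin (w * x))" for x
    by (intro mult_nonneg_nonneg one_plus_sin_nonneg) simp
  have i: "integrable lborel (\<lambda>x. std_normal_density x * sin (w * x))"
    by (intro integrable_mult_bounded) auto
  have split: "std_normal_density x * (1 + sin (w * x)) = std_normal_density x + std_normal_density x * sin (w * x)" for x
    by (simp add: algebra_simps)
  have "emeasure (oscillating_normal w) UNIV = (\<integral>\<^sup>+x. ennreal (std_normal_density x * (1 + sin (w * x))) \<partial>lborel)"
    by (simp add: oscillating_normal_def emeasure_density)
  also have "\<dots> = ennreal (\<integral>x. std_normal_density x * (1 + sin (w * x)) \<partial>lborel)"
    using i nn unfolding split by (intro nn_integral_eq_integral) (auto simp: split)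
  also have "\<dots> = 1"
    unfolding split using i integral_std_normal_cos_sin(2)[of w] by simp
  finally show "emeasure (oscillating_normal w) (space (oscillating_normal w)) = 1" by simp
qed

lemma integrable_std_normal_abs: "integrable std_normal_distribution (\<lambda>x. \<bar>x\<bar>)"
  using integrable_normal_abs[of 1] by (simp add: integrable_density)

text \<open>The law of the first coordinate is a parameter, so that one construction yields both
  measures: \<open>P\<close> is the oscillating normal law for one and the standard normal law for
  the other.\<close>

definition gauss_with_first :: "nat \<Rightarrow> real measure \<Rightarrow> (nat \<Rightarrow> real) measure" where
  "gauss_with_first d P = Pi\<^sub>M {..<d} (\<lambda>i. if i = 0 then P else std_normal_distribution)"

lemma sets_gauss_with_first:
  assumes "sets P = sets borel"
  shows "sets (gauss_with_first d P) = sets (borel_Rd d)"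
  unfolding gauss_with_first_def using assms by (intro sets_PiM_cong) auto

lemma space_gauss_with_first:
  assumes "sets P = sets borel"
  shows "space (gauss_with_first d P) = Rd d"
  using sets_eq_imp_space_eq[OF sets_gauss_with_first[OF assms]] by (simp add: space_PiM)

lemma prob_space_gauss_with_first: "prob_space P \<Longrightarrow> prob_space (gauss_with_first d P)"
  unfolding gauss_with_first_def using prob_space_std_normal by (intro prob_space_PiM) auto

lemma distr_gauss_with_first_component:
  assumes "prob_space P" "i < d"
  shows "distr (gauss_with_first d P) (if i = 0 then P else std_normal_distribution) (\<lambda>x. x i)
    = (if i = 0 then P else std_normal_distribution)"
  unfolding gauss_with_first_def using assms prob_space_std_normal
  using distr_PiM_component[of "{..<d}" "\<lambda>i. if i = 0 then P else std_normal_distribution" i] by auto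

lemma integrable_gauss_with_first_abs:
  assumes P: "prob_space P" "sets P = sets borel" and int: "integrable P (\<lambda>x. \<bar>x\<bar>)" and i: "i < d"
  shows "integrable (gauss_with_first d P) (\<lambda>x. \<bar>x i\<bar>)"
proof -
  let ?Q = "if i = 0 then P else std_normal_distribution"
  have "(\<lambda>x. x i) \<in> measurable (gauss_with_first d P) ?Q"
    unfolding gauss_with_first_def using i by (intro measurable_component_singleton) auto
  then show ?thesis
    using int integrable_std_normal_abs distr_gauss_with_first_component[OF P(1) i]
    by (subst integrable_distr_eq[of "\<lambda>x. x i" _ ?Q "\<lambda>x. \<bar>x\<bar>", symmetric]) (auto simp: P(2) split: if_splits)
qed

lemma measurable_inner_Rd [measurable]: "inner_Rd d \<theta> \<in> borel_measurable (borel_Rd d)"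
  unfolding inner_Rd_def[abs_def] by measurable

text \<open>Coordinates under a product measure are independent, and for independent normal
  variables the variances add up.\<close>

lemma gaussian_linear_form:
  fixes \<theta> :: "nat \<Rightarrow> real"
  assumes J: "finite J" and pos: "0 < (\<Sum>i\<in>J. (\<theta> i)\<^sup>2)"
  shows "distributed (Pi\<^sub>M J (\<lambda>_. std_normal_distribution)) lborel (\<lambda>z. \<Sum>i\<in>J. \<theta> i * z i)
    (normal_density 0 (sqrt (\<Sum>i\<in>J. (\<theta> i)\<^sup>2)))"
proof -
  let ?N = "std_normal_distribution" and ?M = "Pi\<^sub>M J (\<lambda>_. std_normal_distribution)"
  interpret M: prob_space ?M by (intro prob_space_PiM prob_space_std_normal)
  \<comment> \<open>Terms with coefficient zero are dropped, since a normal density needs a positive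
    deviation. Neither sum changes.\<close>
  define K where "K = {i \<in> J. \<theta> i \<noteq> 0}"
  have "K \<subseteq> J" "finite K" using J by (auto simp: K_def)
  have sumK: "(\<Sum>i\<in>J. (\<theta> i)\<^sup>2) = (\<Sum>i\<in>K. (\<theta> i)\<^sup>2)" "(\<Sum>i\<in>J. \<theta> i * z i) = (\<Sum>i\<in>K. \<theta> i * z i)" for z
    using J by (auto simp: K_def intro!: sum.mono_neutral_right)
  have "K \<noteq> {}" using pos unfolding sumK by auto
  have "J \<noteq> {}" using pos by auto
  have comp: "distr ?M ?N (\<lambda>z. z i) = ?N" if "i \<in> J" for i
    using distr_PiM_component[of J "\<lambda>_. ?N" i] prob_space_std_normal that by simp
  \<comment> \<open>Independence means that the joint law is the product of the marginals. Here the
    joint law of the coordinates is the product measure itself.\<close>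
  have "M.indep_vars (\<lambda>_. ?N) (\<lambda>i z. z i) J"
  proof (subst M.indep_vars_iff_distr_eq_PiM')
    have "distr ?M ?M (\<lambda>x. \<lambda>i\<in>J. x i) = distr ?M ?M (\<lambda>x. x)"
      by (intro distr_cong refl) (auto simp: space_PiM)
    also have "\<dots> = ?M" by (rule distr_id)
    also have "\<dots> = Pi\<^sub>M J (\<lambda>i. distr ?M ?N (\<lambda>z. z i))"
      by (intro PiM_cong refl) (simp add: comp)
    finally show "distr ?M ?M (\<lambda>x. \<lambda>i\<in>J. x i) = Pi\<^sub>M J (\<lambda>i. distr ?M ?N (\<lambda>z. z i))" .
  qed (use \<open>J \<noteq> {}\<close> in auto)
  then have "M.indep_vars (\<lambda>_. ?N) (\<lambda>i z. z i) K"
    using \<open>K \<subseteq> J\<close> by (rule M.indep_vars_subset)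
  then have ind: "M.indep_vars (\<lambda>_. borel) (\<lambda>i z. \<theta> i * z i) K"
    by (rule M.indep_vars_compose2) auto
  have "distributed ?M lborel (\<lambda>z. \<theta> i * z i) (normal_density 0 \<bar>\<theta> i\<bar>)" if "i \<in> K" for i
  proof -
    have "distributed ?M lborel (\<lambda>z. z i) std_normal_density"
      unfolding distributed_def
    proof (intro conjI)
      have "distr ?M lborel (\<lambda>z. z i) = distr ?M ?N (\<lambda>z. z i)" by (rule distr_cong) auto
      then show "distr ?M lborel (\<lambda>z. z i) = ?N" using comp[of i] that \<open>K \<subseteq> J\<close> by auto
      have "(\<lambda>z. z i) \<in> measurable ?M ?N"
        using that \<open>K \<subseteq> J\<close> by (intro measurable_component_singleton) auto
      then show "(\<lambda>z. z i) \<in> measurable ?M lborel" by simp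
    qed auto
    from M.normal_density_affine[OF this, of "\<theta> i" 0] that show ?thesis by (simp add: K_def)
  qed
  with \<open>finite K\<close> \<open>K \<noteq> {}\<close> ind have "distributed ?M lborel (\<lambda>z. \<Sum>i\<in>K. \<theta> i * z i)
      (normal_density (\<Sum>i\<in>K. 0) (sqrt (\<Sum>i\<in>K. \<bar>\<theta> i\<bar>\<^sup>2)))"
    by (intro M.sum_indep_normal) (auto simp: K_def)
  then show ?thesis by (simp add: sumK)
qed

section \<open>The discrepancy of a single ridge function\<close>

text \<open>Each term of the bound is a product of a function of the parameters and a function of
  \<open>x\<close>. It therefore serves as a dominating function both for a fixed neuron and jointly
  in the neuron and the point.\<close>

lemma abs_relu_inner_le:
  "\<bar>relu (inner_Rd d \<theta> x - b)\<bar> \<le> (\<Sum>i<d. \<bar>\<theta> i\<bar> * \<bar>x i\<bar>) + \<bar>b\<bar>"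
proof -
  have "\<bar>inner_Rd d \<theta> x\<bar> \<le> (\<Sum>i<d. \<bar>\<theta> i * x i\<bar>)"
    unfolding inner_Rd_def by (rule sum_abs)
  then show ?thesis
    using abs_relu_le[of "inner_Rd d \<theta> x - b"] by (simp add: abs_mult)
qed

lemma integrable_relu_gauss_with_first:
  assumes P: "prob_space P" "sets P = sets borel" and int: "integrable P (\<lambda>x. \<bar>x\<bar>)"
  shows "integrable (gauss_with_first d P) (\<lambda>x. relu (inner_Rd d \<theta> x - b))"
proof (rule Bochner_Integration.integrable_bound)
  interpret prob_space "gauss_with_first d P" by (rule prob_space_gauss_with_first[OF P(1)])
  note [measurable_cong] = sets_gauss_with_first[OF P(2), of d]
  show "integrable (gauss_with_first d P) (\<lambda>x. (\<Sum>i<d. \<bar>\<theta> i\<bar> * \<bar>x i\<bar>) + \<bar>b\<bar>)"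
    by (intro Bochner_Integration.integrable_add Bochner_Integration.integrable_sum
        integrable_mult_right integrable_const integrable_gauss_with_first_abs[OF P int]) auto
  show "(\<lambda>x. relu (inner_Rd d \<theta> x - b)) \<in> borel_measurable (gauss_with_first d P)"
    by measurable
  show "AE x in gauss_with_first d P. norm (relu (inner_Rd d \<theta> x - b)) \<le> norm ((\<Sum>i<d. \<bar>\<theta> i\<bar> * \<bar>x i\<bar>) + \<bar>b\<bar>)"
    using abs_relu_inner_le[of d \<theta> _ b] by (auto intro: order_trans[OF _ abs_ge_self])
qed

text \<open>Fubini after splitting off the first coordinate. Its law \<open>P\<close> is integrated
  innermost, because only there do the two measures differ.\<close>

lemma integral_relu_gauss_with_first:
  fixes \<theta> :: "nat \<Rightarrow> real"
  assumes d: "d > 0"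
    and P: "prob_space P" "sets P = sets borel" and int: "integrable P (\<lambda>x. \<bar>x\<bar>)"
  defines "G \<equiv> Pi\<^sub>M {1..<d} (\<lambda>_. std_normal_distribution)"
    and "Y \<equiv> (\<lambda>z. \<Sum>i\<in>{1..<d}. \<theta> i * z i)"
  shows "integrable G (\<lambda>z. \<integral>x. relu (\<theta> 0 * x + Y z - b) \<partial>P)"
    and "(\<integral>x. relu (inner_Rd d \<theta> x - b) \<partial>gauss_with_first d P)
       = (\<integral>z. (\<integral>x. relu (\<theta> 0 * x + Y z - b) \<partial>P) \<partial>G)"
proof -
  let ?M = "\<lambda>i::nat. if i = 0 then P else std_normal_distribution"
  let ?f = "\<lambda>x. relu (inner_Rd d \<theta> x - b)"
  let ?T = "\<lambda>(x, X). X(0 := x) :: nat \<Rightarrow> real"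
  interpret P: prob_space P by fact
  interpret G: prob_space G unfolding G_def by (intro prob_space_PiM prob_space_std_normal)
  interpret PG: pair_prob_space P G ..
  note [measurable_cong] = P(2)
  have ins: "{..<d} = insert 0 {1..<d}" using d by auto
  have GM: "Pi\<^sub>M {1..<d} ?M = G" unfolding G_def by (intro PiM_cong) auto
  \<comment> \<open>Inserting an independent first coordinate into the remaining
    \<open>d - 1\<close> ones reproduces the full product measure.\<close>
  have "distr (P \<Otimes>\<^sub>M Pi\<^sub>M {1..<d} ?M) (Pi\<^sub>M (insert 0 {1..<d}) ?M) ?T = Pi\<^sub>M (insert 0 {1..<d}) ?M"
    using distr_pair_PiM_eq_PiM[of "{1..<d}" ?M 0] P(1) prob_space_std_normal by simp
  then have dist: "distr (P \<Otimes>\<^sub>M G) (gauss_with_first d P) ?T = gauss_with_first d P"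
    unfolding gauss_with_first_def ins GM .
  have T: "?T \<in> measurable (P \<Otimes>\<^sub>M G) (gauss_with_first d P)"
    unfolding gauss_with_first_def ins split_beta' G_def
    by (rule measurable_PiM_single') (auto simp: space_pair_measure space_PiM PiE_iff extensional_def split: if_splits)
  have fT: "?f (X(0 := x)) = relu (\<theta> 0 * x + Y X - b)" for x X
    unfolding inner_Rd_def Y_def ins by (subst sum.insert) auto
  have f: "?f \<in> borel_measurable (gauss_with_first d P)"
    using integrable_relu_gauss_with_first[OF P int, of d \<theta> b] by simp
  have "integrable (P \<Otimes>\<^sub>M G) (\<lambda>p. ?f (?T p))"
    using integrable_relu_gauss_with_first[OF P int, of d \<theta> b]
    by (subst integrable_distr_eq[OF T f, symmetric]) (simp add: dist)
  then have i: "integrable (P \<Otimes>\<^sub>M G) (\<lambda>(x, z). relu (\<theta> 0 * x + Y z - b))"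
    by (simp add: split_beta' fT)
  from PG.integrable_snd[OF i] show "integrable G (\<lambda>z. \<integral>x. relu (\<theta> 0 * x + Y z - b) \<partial>P)" .
  have "integral\<^sup>L (gauss_with_first d P) ?f = (\<integral>p. ?f (?T p) \<partial>(P \<Otimes>\<^sub>M G))"
    by (subst dist[symmetric], rule integral_distr[OF T f])
  also have "\<dots> = (\<integral>(x, z). relu (\<theta> 0 * x + Y z - b) \<partial>(P \<Otimes>\<^sub>M G))"
    by (simp add: split_beta' fT)
  also have "\<dots> = (\<integral>z. (\<integral>x. relu (\<theta> 0 * x + Y z - b) \<partial>P) \<partial>G)"
    using PG.integral_snd[OF i] by simp
  finally show "(\<integral>x. relu (inner_Rd d \<theta> x - b) \<partial>gauss_with_first d P)
       = (\<integral>z. (\<integral>x. relu (\<theta> 0 * x + Y z - b) \<partial>P) \<partial>G)" .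
qed

lemma integrable_relu_std_normal: "integrable std_normal_distribution (\<lambda>x. relu (u * x + c))"
proof (rule Bochner_Integration.integrable_bound)
  interpret prob_space std_normal_distribution by (rule prob_space_std_normal)
  show "integrable std_normal_distribution (\<lambda>x. \<bar>u\<bar> * \<bar>x\<bar> + \<bar>c\<bar>)"
    using integrable_std_normal_abs by simp
  have "\<bar>relu (u * x + c)\<bar> \<le> \<bar>\<bar>u\<bar> * \<bar>x\<bar> + \<bar>c\<bar>\<bar>" for x
    using abs_relu_le[of "u * x + c"] by (simp add: abs_mult[symmetric])
  then show "AE x in std_normal_distribution. norm (relu (u * x + c)) \<le> norm (\<bar>u\<bar> * \<bar>x\<bar> + \<bar>c\<bar>)"
    by simp
qed measurable

text \<open>The effect of changing the measure on a single neuron. Functions of the kernel space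
  superpose neurons by an integral, networks by a finite sum, so both estimates reduce to this
  quantity.\<close>

definition discrepancy :: "nat \<Rightarrow> real \<Rightarrow> (nat \<Rightarrow> real) \<Rightarrow> real \<Rightarrow> real" where
  "discrepancy d w \<theta> b =
     (\<integral>x. relu (inner_Rd d \<theta> x - b) \<partial>gauss_with_first d (oscillating_normal w))
   - (\<integral>x. relu (inner_Rd d \<theta> x - b) \<partial>gauss_with_first d std_normal_distribution)"

lemma integrable_oscillating_normal_abs: "integrable (oscillating_normal w) (\<lambda>x. \<bar>x\<bar>)"
  by (rule oscillating_normal_integral(1)[OF integrable_std_normal_abs])

text \<open>The outer integral over the other coordinates is common to both measures, so the
  difference passes to the inner integral, where only the sine term survives.\<close>

lemma discrepancy_eq:
  fixes \<theta> :: "nat \<Rightarrow> real"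
  assumes d: "d > 0"
  shows "discrepancy d w \<theta> b = (\<integral>z. (\<integral>x. std_normal_density x *
      (sin (w * x) * relu (\<theta> 0 * x + (\<Sum>i\<in>{1..<d}. \<theta> i * z i) - b)) \<partial>lborel)
    \<partial>Pi\<^sub>M {1..<d} (\<lambda>_. std_normal_distribution))"
proof -
  have *: "(\<integral>x. relu (\<theta> 0 * x + y - b) \<partial>oscillating_normal w)
      - (\<integral>x. relu (\<theta> 0 * x + y - b) \<partial>std_normal_distribution)
      = (\<integral>x. std_normal_density x * (sin (w * x) * relu (\<theta> 0 * x + y - b)) \<partial>lborel)" for y
    using oscillating_normal_integral(2)[OF integrable_relu_std_normal[of "\<theta> 0" "y - b"], of w]
    by (simp add: add_diff_eq)
  note O = prob_space_oscillating_normal sets_oscillating_normal integrable_oscillating_normal_abs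
  note N = prob_space_std_normal _ integrable_std_normal_abs
  show ?thesis
    unfolding discrepancy_def integral_relu_gauss_with_first(2)[OF d O] *[symmetric]
    by (subst integral_relu_gauss_with_first(2)[OF d N], simp,
        subst Bochner_Integration.integral_diff)
      (use integral_relu_gauss_with_first(1)[OF d O, of w] integral_relu_gauss_with_first(1)[OF d N] in simp_all)
qed

text \<open>The coordinates other than the first contribute a normal variable of variance
  \<open>1 - (\<theta> 0)\<^sup>2\<close> to the inner product, independent of the first one. This
  is the smoothing variable \<open>y\<close> of \<open>oscillation_smoothing\<close>, with
  \<open>u = \<theta> 0\<close>.\<close>

lemma abs_discrepancy_le:
  assumes d: "d > 0" and \<theta>: "norm_Rd d \<theta> = 1"
  shows "\<bar>discrepancy d w \<theta> b\<bar> \<le> exp (- w\<^sup>2 * (1 - (\<theta> 0)\<^sup>2) / 2) * (1 + \<bar>b\<bar>)"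
proof -
  let ?S = "\<Sum>i\<in>{1..<d}. (\<theta> i)\<^sup>2" and ?Y = "\<lambda>z. \<Sum>i\<in>{1..<d}. \<theta> i * z i"
  let ?G = "Pi\<^sub>M {1..<d} (\<lambda>_. std_normal_distribution)"
  define v where "v = sqrt ?S"
  have ins: "{..<d} = insert 0 {1..<d}" using d by auto
  have "(\<Sum>i<d. (\<theta> i)\<^sup>2) = 1" using \<theta> by (simp add: L2_set_def)
  then have sum1: "(\<theta> 0)\<^sup>2 + ?S = 1" unfolding ins by (subst (asm) sum.insert) auto
  have v2: "v\<^sup>2 = ?S" unfolding v_def by (simp add: sum_nonneg)
  define F where "F = (\<lambda>x y. std_normal_density x * (sin (w * x) * relu (\<theta> 0 * x + y - b)))"
  have F_meas: "(\<lambda>y. \<integral>x. F x y \<partial>lborel) \<in> borel_measurable borel"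
    unfolding F_def by measurable
  have eq: "discrepancy d w \<theta> b = (\<integral>z. (\<integral>x. F x (?Y z) \<partial>lborel) \<partial>?G)"
    unfolding discrepancy_eq[OF d] F_def ..
  show ?thesis
  proof (cases "?S = 0")
    case False
    then have S: "0 < ?S" by (simp add: sum_nonneg less_le)
    then have v: "v > 0" by (simp add: v_def)
    have "discrepancy d w \<theta> b = (\<integral>y. normal_density 0 v y * (\<integral>x. F x y \<partial>lborel) \<partial>lborel)"
      unfolding eq v_def using F_meas
      by (subst distributed_integral[OF gaussian_linear_form[OF _ S], symmetric]) auto
    also have "\<dots> = (\<integral>y. (\<integral>x. std_normal_density x * normal_density 0 v y *
        (sin (w * x) * relu (\<theta> 0 * x + y - b)) \<partial>lborel) \<partial>lborel)"
      by (simp add: F_def mult_ac flip: integral_mult_right_zero)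
    also have "\<bar>\<dots>\<bar> \<le> exp (- (w * v)\<^sup>2 / 2) * (1 + \<bar>b\<bar>)"
      using v sum1 v2 by (intro oscillation_smoothing) auto
    also have "(w * v)\<^sup>2 = w\<^sup>2 * (1 - (\<theta> 0)\<^sup>2)"
      using sum1 v2 by (simp add: power_mult_distrib)
    finally show ?thesis by simp
  next
    \<comment> \<open>If \<open>\<theta>\<close> lies on the first axis, the smoothing variable
      degenerates to the constant 0 and has no density. The claimed damping factor is then 1, and
      the first absolute moment suffices.\<close>
    case True
    interpret G: prob_space ?G by (intro prob_space_PiM prob_space_std_normal)
    have \<theta>0: "\<theta> i = 0" if "i \<in> {1..<d}" for i
      using True that by (simp add: sum_nonneg_eq_0_iff)
    have u: "(\<theta> 0)\<^sup>2 = 1" using sum1 True by simp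
    then have u': "\<bar>\<theta> 0\<bar> = 1" by (auto simp: power2_eq_1_iff)
    have "discrepancy d w \<theta> b = (\<integral>x. F x 0 \<partial>lborel)"
      unfolding eq using \<theta>0 G.prob_space by simp
    also have "\<bar>\<dots>\<bar> \<le> (\<integral>x. std_normal_density x * \<bar>x\<bar> + \<bar>b\<bar> * std_normal_density x \<partial>lborel)"
    proof (rule integral_abs_bound[THEN order_trans], rule integral_mono')
      show "integrable lborel (\<lambda>x. std_normal_density x * \<bar>x\<bar> + \<bar>b\<bar> * std_normal_density x)"
        using integrable_normal_abs[of 1] by simp
      show "\<bar>F x 0\<bar> \<le> std_normal_density x * \<bar>x\<bar> + \<bar>b\<bar> * std_normal_density x" for x
      proof -
        have "\<bar>relu (\<theta> 0 * x + 0 - b)\<bar> \<le> \<bar>\<theta> 0\<bar> * \<bar>x\<bar> + \<bar>b\<bar>"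
          using abs_relu_le[of "\<theta> 0 * x + 0 - b"] by (simp add: abs_mult[symmetric])
        then have "\<bar>sin (w * x)\<bar> * \<bar>relu (\<theta> 0 * x + 0 - b)\<bar> \<le> 1 * (\<bar>x\<bar> + \<bar>b\<bar>)"
          unfolding u' by (intro mult_mono) auto
        then have "std_normal_density x * (\<bar>sin (w * x)\<bar> * \<bar>relu (\<theta> 0 * x + 0 - b)\<bar>) \<le> std_normal_density x * (\<bar>x\<bar> + \<bar>b\<bar>)"
          by (intro mult_left_mono) auto
        then show ?thesis by (simp add: F_def abs_mult algebra_simps)
      qed
    qed (simp add: add_nonneg_nonneg)
    also have "\<dots> \<le> 1 + \<bar>b\<bar>"
      using integrable_normal_abs[of 1] integral_std_normal_abs_le by simp
    finally show ?thesis using u by simp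
  qed
qed

section \<open>Concentration on the sphere\<close>

text \<open>A product measure is determined by its values on boxes, and on a box the claim factors
  into the one-dimensional affine rule for each side.\<close>

lemma emeasure_PiM_lborel_affine:
  fixes c :: real and a :: "'i \<Rightarrow> real"
  assumes I: "finite I" and c: "c > 0" and A: "A \<in> sets (Pi\<^sub>M I (\<lambda>_. lborel))"
  defines "T \<equiv> \<lambda>x. \<lambda>i\<in>I. a i + c * x i"
  shows "ennreal (c ^ card I) * emeasure (Pi\<^sub>M I (\<lambda>_. lborel)) (T -` A \<inter> space (Pi\<^sub>M I (\<lambda>_. lborel)))
    = emeasure (Pi\<^sub>M I (\<lambda>_. lborel)) A"
proof -
  let ?L = "Pi\<^sub>M I (\<lambda>_. lborel :: real measure)"
  interpret product_sigma_finite "\<lambda>_::'i. lborel :: real measure" ..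
  have T: "T \<in> measurable ?L ?L"
    unfolding T_def by (rule measurable_restrict) auto
  have "scale_measure (ennreal (c ^ card I)) (distr ?L ?L T) = ?L"
  proof (rule PiM_eqI[OF I])
    fix B :: "'i \<Rightarrow> real set" assume B: "\<And>i. i \<in> I \<Longrightarrow> B i \<in> sets lborel"
    have B': "(\<lambda>x. a i + c * x) -` B i \<in> sets borel" if "i \<in> I" for i
      using measurable_sets_borel[of "\<lambda>x. a i + c * x" borel "B i"] B[OF that] by simp
    have one: "ennreal c * emeasure lborel ((\<lambda>x. a i + c * x) -` B i) = emeasure lborel (B i)" if "i \<in> I" for i
    proof -
      have "emeasure lborel (B i) = emeasure (density (distr lborel borel (\<lambda>x. a i + c * x)) (\<lambda>_. ennreal \<bar>c\<bar>)) (B i)"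
        using c by (subst lborel_real_affine[of c "a i"]) auto
      also have "\<dots> = ennreal c * emeasure lborel ((\<lambda>x. a i + c * x) -` B i)"
        using B[OF that] c by (simp add: emeasure_density_const emeasure_distr)
      finally show ?thesis ..
    qed
    have pre: "T -` Pi\<^sub>E I B \<inter> space ?L = Pi\<^sub>E I (\<lambda>i. (\<lambda>x. a i + c * x) -` B i)"
      by (auto simp: T_def space_PiM PiE_iff)
    have "emeasure (scale_measure (ennreal (c ^ card I)) (distr ?L ?L T)) (Pi\<^sub>E I B)
        = ennreal (c ^ card I) * emeasure ?L (Pi\<^sub>E I (\<lambda>i. (\<lambda>x. a i + c * x) -` B i))"
      using B I T by (simp add: emeasure_distr sets_PiM_I_finite pre)
    also have "\<dots> = (\<Prod>i\<in>I. ennreal c) * (\<Prod>i\<in>I. emeasure lborel ((\<lambda>x. a i + c * x) -` B i))"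
      using B' I c by (subst emeasure_PiM) (auto simp: ennreal_power)
    also have "\<dots> = (\<Prod>i\<in>I. emeasure lborel (B i))"
      unfolding prod.distrib[symmetric] by (intro prod.cong refl one)
    finally show "emeasure (scale_measure (ennreal (c ^ card I)) (distr ?L ?L T)) (Pi\<^sub>E I B) = (\<Prod>i\<in>I. emeasure lborel (B i))" .
  qed simp
  then have "emeasure ?L A = emeasure (scale_measure (ennreal (c ^ card I)) (distr ?L ?L T)) A"
    by simp
  also have "\<dots> = ennreal (c ^ card I) * emeasure ?L (T -` A \<inter> space ?L)"
    using A T by (simp add: emeasure_distr)
  finally show ?thesis ..
qed

text \<open>
  The part of the unit ball on the rays through the cap around \<open>s\<close> times the first basis vector lies
  in the ball of radius \<open>1 / sqrt 2\<close> centred at \<open>s / sqrt 2\<close> times that vector.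
\<close>

lemma unif_sphere_cap_half:
  fixes s :: real
  assumes d: "d > 0" and s: "s\<^sup>2 = 1"
  shows "measure (unif_sphere d) {\<theta> \<in> Rd d. 1 \<le> sqrt 2 * s * \<theta> 0} \<le> (1 / sqrt 2) ^ d"
proof -
  let ?L = "Pi\<^sub>M {..<d} (\<lambda>_. lborel :: real measure)" and ?B = "unit_ball_Rd d"
  let ?U = "uniform_measure ?L ?B"
  let ?C = "{\<theta> \<in> Rd d. 1 \<le> sqrt 2 * s * \<theta> 0}"
  \<comment> \<open>\<open>T\<close> maps the ball of radius \<open>1 / sqrt 2\<close> around
    \<open>s / sqrt 2\<close> times the first basis vector onto the unit ball, so membership in the
    small ball reads \<open>norm_Rd d (T x) \<le> 1\<close>.\<close>
  define T where "T = (\<lambda>x. \<lambda>i\<in>{..<d}. (if i = 0 then - s else 0) + sqrt 2 * x i)"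
  have ins: "{..<d} = insert 0 {1..<d}" using d by auto
  have spL: "space ?L = Rd d" by (simp add: space_PiM)
  have "?C = {\<theta> \<in> space (borel_Rd d). 1 \<le> sqrt 2 * s * \<theta> 0}" by (simp add: space_PiM)
  moreover have "(\<lambda>\<theta>. \<theta> 0) \<in> borel_measurable (borel_Rd d)"
    using d by (intro measurable_component_singleton) auto
  ultimately have C: "?C \<in> sets (borel_Rd d)" by simp
  have sub: "?B \<inter> (normalize_Rd d -` ?C \<inter> space ?L) \<subseteq> T -` ?B \<inter> space ?L"
  proof
    fix x assume x: "x \<in> ?B \<inter> (normalize_Rd d -` ?C \<inter> space ?L)"
    define r where "r = norm_Rd d x"
    have r: "0 \<le> r" "r \<le> 1" using x by (auto simp: unit_ball_Rd_def r_def)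
    have "1 \<le> sqrt 2 * s * (x 0 / r)"
      using x d by (auto simp: normalize_Rd_def r_def)
    \<comment> \<open>For \<open>r = 0\<close> the quotient is 0 by convention, which contradicts
      the lower bound 1.\<close>
    moreover from this have "0 < r" using r by (cases "r = 0") auto
    ultimately have "r \<le> sqrt 2 * s * x 0" by (simp add: pos_le_divide_eq)
    have sum: "(\<Sum>i<d. (x i)\<^sup>2) = r\<^sup>2" unfolding r_def L2_set_def by (simp add: sum_nonneg)
    have "(\<Sum>i<d. (T x i)\<^sup>2) = (T x 0)\<^sup>2 + (\<Sum>i\<in>{1..<d}. (T x i)\<^sup>2)"
      unfolding ins by (subst sum.insert) auto
    also have "(T x 0)\<^sup>2 = 1 - 2 * (sqrt 2 * s * x 0) + 2 * (x 0)\<^sup>2"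
      using d s by (simp add: T_def power2_eq_square algebra_simps)
    also have "(\<Sum>i\<in>{1..<d}. (T x i)\<^sup>2) = 2 * (\<Sum>i\<in>{1..<d}. (x i)\<^sup>2)"
      by (auto simp: T_def power_mult_distrib sum_distrib_left intro!: sum.cong)
    also have "1 - 2 * (sqrt 2 * s * x 0) + 2 * (x 0)\<^sup>2 + 2 * (\<Sum>i\<in>{1..<d}. (x i)\<^sup>2)
        = 1 - 2 * (sqrt 2 * s * x 0) + 2 * r\<^sup>2"
      using sum unfolding ins by (subst (asm) sum.insert) auto
    \<comment> \<open>The cap condition enters here; \<open>r * (1 - r) \<ge> 0\<close> in the unit
      ball then finishes the bound.\<close>
    also have "\<dots> \<le> 1 - 2 * r + 2 * r\<^sup>2" using \<open>r \<le> sqrt 2 * s * x 0\<close> by simp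
    also have "\<dots> = 1 - 2 * (r * (1 - r))" by (simp add: power2_eq_square algebra_simps)
    also have "\<dots> \<le> 1" using r by simp
    finally have "norm_Rd d (T x) \<le> 1" by (simp add: L2_set_def)
    moreover have "T x \<in> Rd d" by (simp add: T_def)
    ultimately show "x \<in> T -` ?B \<inter> space ?L" using x by (auto simp: unit_ball_Rd_def spL)
  qed
  have Tm: "T \<in> measurable ?L ?L"
    unfolding T_def by (rule measurable_restrict) auto
  have pre: "normalize_Rd d -` ?C \<inter> space ?L \<in> sets ?L"
    by (rule measurable_sets[OF measurable_normalize_Rd C])
  let ?E = "emeasure ?L (T -` ?B \<inter> space ?L)"
  have sq2: "sqrt 2 ^ d > (0::real)" by simp
  \<comment> \<open>\<open>T\<close> expands by \<open>sqrt 2\<close> in each of the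
    \<open>d\<close> coordinates, so the small ball takes up the fraction
    \<open>(1 / sqrt 2) ^ d\<close> of the unit ball.\<close>
  have scale: "ennreal (sqrt 2 ^ d) * ?E = emeasure ?L ?B"
    unfolding T_def
    using emeasure_PiM_lborel_affine[of "{..<d}" "sqrt 2" ?B "\<lambda>i. if i = 0 then - s else 0"] unit_ball_Rd_sets[of d]
    by simp
  obtain e where e: "e \<ge> 0" "emeasure ?L ?B = ennreal e"
    using unit_ball_Rd_emeasure(2)[of d] by (cases "emeasure ?L ?B") auto
  have "e > 0" using unit_ball_Rd_emeasure(1)[of d] e by (cases "e = 0") auto
  have "?E = ennreal (e / sqrt 2 ^ d)"
  proof -
    have "?E = ennreal (1 / sqrt 2 ^ d) * (ennreal (sqrt 2 ^ d) * ?E)"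
      using sq2 by (simp add: mult.assoc[symmetric] ennreal_mult[symmetric])
    also have "\<dots> = ennreal (e / sqrt 2 ^ d)"
      unfolding scale e(2) using e by (subst ennreal_mult[symmetric]) auto
    finally show ?thesis .
  qed
  have "emeasure (unif_sphere d) ?C = emeasure ?U (normalize_Rd d -` ?C \<inter> space ?U)"
    unfolding unif_sphere_def by (rule emeasure_distr[OF measurable_normalize_uniform C])
  also have "\<dots> = emeasure ?L (?B \<inter> (normalize_Rd d -` ?C \<inter> space ?L)) / emeasure ?L ?B"
    using pre unit_ball_Rd_sets by (simp add: emeasure_uniform_measure)
  also have "\<dots> \<le> ?E / emeasure ?L ?B"
    using sub unit_ball_Rd_sets by (intro divide_right_mono_ennreal emeasure_mono measurable_sets[OF Tm])
  also have "\<dots> = ennreal ((e / sqrt 2 ^ d) / e)"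
    unfolding e(2) \<open>?E = _\<close> using \<open>e > 0\<close> by (intro divide_ennreal) auto
  also have "(e / sqrt 2 ^ d) / e = (1 / sqrt 2) ^ d" using \<open>e > 0\<close> by (simp add: power_one_over)
  finally have "emeasure (unif_sphere d) ?C \<le> ennreal ((1 / sqrt 2) ^ d)" .
  then show ?thesis
    unfolding measure_def by (intro enn2real_leI) auto
qed

lemma sets_unif_sphere [simp, measurable_cong]: "sets (unif_sphere d) = sets (borel_Rd d)"
  by (simp add: unif_sphere_def)

lemma space_unif_sphere [simp]: "space (unif_sphere d) = Rd d"
  by (simp add: unif_sphere_def space_PiM)

text \<open>Turns the cap estimate into an exponential of rate 1/8. The square root taken in the
  Cauchy-Schwarz argument halves this to the rate 1/16 of the final bound.\<close>

lemma exp_neg_eighth_ge: "1 / sqrt 2 \<le> exp (- 1 / 8 :: real)"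
proof -
  have "8 / 7 \<le> sqrt (2::real)" by (rule real_le_rsqrt) (simp add: power2_eq_square)
  then have "1 / sqrt 2 \<le> (7 / 8 :: real)" by (simp add: field_simps)
  also have "\<dots> \<le> exp (- 1 / 8)" using exp_ge_add_one_self[of "- 1 / 8 :: real"] by simp
  finally show ?thesis .
qed

text \<open>The integrand is the squared damping factor for \<open>w\<^sup>2 = d\<close>. It is at
  most 1 on the two caps around the poles of the first axis, which are exponentially small, and
  itself exponentially small between them. The truncation by 1 makes it bounded off the sphere as
  well, where \<open>\<bar>\<theta> 0\<bar>\<close> may exceed 1.\<close>

lemma integral_unif_sphere_exp_le:
  assumes d: "d > 0"
  shows "(\<integral>\<theta>. min 1 (exp (- real d * (1 - (\<theta> 0)\<^sup>2))) \<partial>unif_sphere d) \<le> 3 * exp (- real d / 8)"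
proof -
  interpret prob_space "unif_sphere d" by (rule prob_space_unif_sphere)
  define C where "C = (\<lambda>s. {\<theta> \<in> Rd d. 1 \<le> sqrt 2 * s * \<theta> 0})"
  have comp [measurable]: "(\<lambda>\<theta>. \<theta> 0) \<in> borel_measurable (unif_sphere d)"
    using d measurable_component_singleton[of 0 "{..<d}" "\<lambda>_. borel :: real measure"]
    by (simp cong: measurable_cong_sets)
  have C: "C s \<in> sets (unif_sphere d)" for s
  proof -
    have "C s = {\<theta> \<in> space (unif_sphere d). 1 \<le> sqrt 2 * s * \<theta> 0}" by (simp add: C_def)
    also have "\<dots> \<in> sets (unif_sphere d)" by measurable
    finally show ?thesis .
  qed
  have pow: "(1 / sqrt 2) ^ d \<le> exp (- real d / 8)"
  proof -
    have "(1 / sqrt 2) ^ d \<le> exp (- 1 / 8 :: real) ^ d"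
      using exp_neg_eighth_ge by (intro power_mono) auto
    also have "\<dots> = exp (- real d / 8)" by (simp add: exp_of_nat_mult[symmetric])
    finally show ?thesis .
  qed
  have mC: "measure (unif_sphere d) (C s) \<le> exp (- real d / 8)" if "s\<^sup>2 = 1" for s
    using unif_sphere_cap_half[OF d that] pow by (simp add: C_def)
  have ind: "integrable (unif_sphere d) (indicator (C s) :: _ \<Rightarrow> real)" for s
    using C by (intro integrable_real_indicator) (auto simp: emeasure_eq_measure)
  then have i: "integrable (unif_sphere d) (\<lambda>\<theta>. exp (- real d / 8) + indicator (C 1) \<theta> + indicator (C (-1)) \<theta> :: real)"
    by (intro Bochner_Integration.integrable_add integrable_const)
  have "(\<integral>\<theta>. min 1 (exp (- real d * (1 - (\<theta> 0)\<^sup>2))) \<partial>unif_sphere d)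
      \<le> (\<integral>\<theta>. exp (- real d / 8) + indicator (C 1) \<theta> + indicator (C (-1)) \<theta> \<partial>unif_sphere d)"
  proof (rule integral_mono)
    show "integrable (unif_sphere d) (\<lambda>\<theta>. min 1 (exp (- real d * (1 - (\<theta> 0)\<^sup>2))))"
      by (rule integrable_const_bound[of _ 1]) auto
    show "integrable (unif_sphere d) (\<lambda>\<theta>. exp (- real d / 8) + indicator (C 1) \<theta> + indicator (C (-1)) \<theta>)"
      by (rule i)
    fix \<theta> assume "\<theta> \<in> space (unif_sphere d)"
    then have Rd: "\<theta> \<in> Rd d" by simp
    show "min 1 (exp (- real d * (1 - (\<theta> 0)\<^sup>2))) \<le> exp (- real d / 8) + indicator (C 1) \<theta> + indicator (C (-1)) \<theta>"
    proof (cases "\<theta> \<in> C 1 \<or> \<theta> \<in> C (-1)")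
      case True
      then have "1 \<le> exp (- real d / 8) + indicator (C 1) \<theta> + indicator (C (-1)) \<theta>"
        by (auto simp: indicator_def)
      then show ?thesis by (rule order_trans[OF min.cobounded1])
    next
      case False
      then have "\<bar>sqrt 2 * \<theta> 0\<bar> \<le> 1" using Rd by (auto simp: C_def abs_le_iff)
      then have "(sqrt 2 * \<theta> 0)\<^sup>2 \<le> 1" by (simp add: abs_square_le_1)
      \<comment> \<open>Between the caps the difference is at least 1/2; the value 1/8 matches the
        rate of the cap estimate.\<close>
      then have "1 / 8 \<le> 1 - (\<theta> 0)\<^sup>2" by (simp add: power_mult_distrib)
      then have "real d * (1 / 8) \<le> real d * (1 - (\<theta> 0)\<^sup>2)" by (intro mult_left_mono) auto
      then have "exp (- real d * (1 - (\<theta> 0)\<^sup>2)) \<le> exp (- real d / 8)" by simp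
      then show ?thesis using False by (auto intro: order_trans[OF min.cobounded2])
    qed
  qed
  also have "\<dots> = exp (- real d / 8) + measure (unif_sphere d) (C 1) + measure (unif_sphere d) (C (-1))"
    using C ind prob_space sets.sets_into_space[OF C]
    by (simp add: Bochner_Integration.integral_add Int_absorb2)
  also have "\<dots> \<le> 3 * exp (- real d / 8)" using mC[of 1] mC[of "-1"] by simp
  finally show ?thesis .
qed

section \<open>Test functions in the kernel space\<close>

lemma integrable_product_mult:
  fixes f :: "'a \<Rightarrow> real" and g :: "'b \<Rightarrow> real"
  assumes "sigma_finite_measure M" "sigma_finite_measure N" and f: "integrable M f" and g: "integrable N g"
  shows "integrable (M \<Otimes>\<^sub>M N) (\<lambda>z. f (fst z) * g (snd z))"
    and "(\<integral>z. f (fst z) * g (snd z) \<partial>(M \<Otimes>\<^sub>M N)) = (\<integral>x. f x \<partial>M) * (\<integral>y. g y \<partial>N)"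
proof -
  interpret pair_sigma_finite M N using assms(1,2) by (simp add: pair_sigma_finite_def)
  have [measurable]: "f \<in> borel_measurable M" "g \<in> borel_measurable N" using f g by auto
  show i: "integrable (M \<Otimes>\<^sub>M N) (\<lambda>z. f (fst z) * g (snd z))"
    using f g by (intro Fubini_integrable) (auto simp: abs_mult)
  show "(\<integral>z. f (fst z) * g (snd z) \<partial>(M \<Otimes>\<^sub>M N)) = (\<integral>x. f x \<partial>M) * (\<integral>y. g y \<partial>N)"
    using integral_fst'[OF i] by simp
qed

lemma sets_feature_measure [measurable_cong]:
  "sets (feature_measure d) = sets (borel_Rd d \<Otimes>\<^sub>M borel)"
  unfolding feature_measure_def by (intro sets_pair_measure_cong) auto

lemma sigma_finite_std_normal: "sigma_finite_measure std_normal_distribution"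
  by (rule prob_space_imp_sigma_finite[OF prob_space_std_normal])

lemma sigma_finite_unif_sphere: "sigma_finite_measure (unif_sphere d)"
  by (rule prob_space_imp_sigma_finite[OF prob_space_unif_sphere])

lemma AE_feature_measure:
  assumes d: "d > 0"
  shows "AE z in feature_measure d. norm_Rd d (fst z) = 1"
proof -
  interpret pair_sigma_finite "unif_sphere d" std_normal_distribution
    using sigma_finite_std_normal sigma_finite_unif_sphere by (simp add: pair_sigma_finite_def)
  have [measurable]: "norm_Rd d \<in> borel_measurable (unif_sphere d)"
    unfolding L2_set_def by measurable
  show ?thesis
    unfolding feature_measure_def
  proof (rule AE_pair_measure)
    show "{x \<in> space (unif_sphere d \<Otimes>\<^sub>M std_normal_distribution). norm_Rd d (fst x) = 1}
        \<in> sets (unif_sphere d \<Otimes>\<^sub>M std_normal_distribution)" by measurable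
    show "AE \<theta> in unif_sphere d. AE b in std_normal_distribution. norm_Rd d (fst (\<theta>, b)) = 1"
      using AE_unif_sphere[OF d] by eventually_elim simp
  qed
qed

lemma abs_component_le_norm_Rd: "i < d \<Longrightarrow> \<bar>\<theta> i\<bar> \<le> norm_Rd d \<theta>"
  using member_le_L2_set[of "{..<d}" i "\<lambda>i. \<bar>\<theta> i\<bar>"] by (simp add: L2_set_def)

lemma std_normal_second_moment:
  "integrable std_normal_distribution (\<lambda>x. x\<^sup>2)" "(\<integral>x. x\<^sup>2 \<partial>std_normal_distribution) = 1"
  using std_normal_distribution_even_moments[of 1] by simp_all

text \<open>A product of two square integrable functions is integrable, which covers the factors 1
  and \<open>snd z\<close>. The components of the direction are bounded by 1 almost
  everywhere.\<close>

lemma L2_feature_integrable: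
  assumes d: "d > 0" and h: "h \<in> L2_functions (feature_measure d)"
  shows "integrable (feature_measure d) h"
    and "integrable (feature_measure d) (\<lambda>z. snd z * h z)"
    and "i < d \<Longrightarrow> integrable (feature_measure d) (\<lambda>z. fst z i * h z)"
proof -
  interpret prob_space "feature_measure d" by (rule prob_space_feature_measure)
  have [measurable]: "h \<in> borel_measurable (feature_measure d)" and h2: "integrable (feature_measure d) (\<lambda>z. (h z)\<^sup>2)"
    using h by (auto simp: L2_functions_def)
  have am: "\<bar>a * b\<bar> \<le> a\<^sup>2 + b\<^sup>2" for a b :: real
  proof -
    have "2 * (\<bar>a\<bar> * \<bar>b\<bar>) \<le> a\<^sup>2 + b\<^sup>2" "0 \<le> \<bar>a\<bar> * \<bar>b\<bar>"
      using sum_squares_bound[of "\<bar>a\<bar>" "\<bar>b\<bar>"] by simp_all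
    then show ?thesis unfolding abs_mult by linarith
  qed
  have b2: "integrable (feature_measure d) (\<lambda>z. (snd z)\<^sup>2)"
    using integrable_product_mult(1)[OF sigma_finite_unif_sphere sigma_finite_std_normal, of d "\<lambda>_. 1" "\<lambda>x. x\<^sup>2"]
      std_normal_second_moment(1) prob_space.finite_measure[OF prob_space_unif_sphere, of d]
    by (simp add: feature_measure_def finite_measure.integrable_const)
  show hi: "integrable (feature_measure d) h"
  proof (rule Bochner_Integration.integrable_bound)
    show "integrable (feature_measure d) (\<lambda>z. 1 + (h z)\<^sup>2)" using h2 by simp
    show "AE z in feature_measure d. norm (h z) \<le> norm (1 + (h z)\<^sup>2)"
      using am[of 1] by simp
  qed measurable
  show "integrable (feature_measure d) (\<lambda>z. snd z * h z)"
  proof (rule Bochner_Integration.integrable_bound)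
    show "integrable (feature_measure d) (\<lambda>z. (snd z)\<^sup>2 + (h z)\<^sup>2)" using h2 b2 by simp
    show "AE z in feature_measure d. norm (snd z * h z) \<le> norm ((snd z)\<^sup>2 + (h z)\<^sup>2)"
      using am by simp
  qed measurable
  assume i: "i < d"
  have [measurable]: "(\<lambda>z. fst z i) \<in> borel_measurable (feature_measure d)"
    using i by (intro measurable_compose[OF measurable_fst measurable_component_singleton]
      measurable_cong_sets[OF sets_feature_measure refl, THEN equalityD2, THEN subsetD]) auto
  show "integrable (feature_measure d) (\<lambda>z. fst z i * h z)"
  proof (rule Bochner_Integration.integrable_bound[OF hi])
    show "AE z in feature_measure d. norm (fst z i * h z) \<le> norm (h z)"
      using AE_feature_measure[OF d]
    proof eventually_elim
      case (elim z)
      then have "\<bar>fst z i\<bar> \<le> 1" using abs_component_le_norm_Rd[OF i, of "fst z"] by simp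
      then show ?case by (simp add: abs_mult mult_left_le_one_le)
    qed
  qed measurable
qed

text \<open>Fubini between the point \<open>x\<close> and the feature \<open>z\<close>: the mean of
  a feature function is the pairing of \<open>h\<close> with the means of the single
  neurons.\<close>

lemma feature_fun_gauss_with_first:
  assumes d: "d > 0" and h: "h \<in> L2_functions (feature_measure d)"
    and P: "prob_space P" "sets P = sets borel" and int: "integrable P (\<lambda>x. \<bar>x\<bar>)"
  defines "R \<equiv> \<lambda>z. \<integral>x. relu (inner_Rd d (fst z) x - snd z) \<partial>gauss_with_first d P"
  shows "integrable (gauss_with_first d P) (feature_fun d h)"
    and "integrable (feature_measure d) (\<lambda>z. R z * h z)"
    and "(\<integral>x. feature_fun d h x \<partial>gauss_with_first d P) = (\<integral>z. R z * h z \<partial>feature_measure d)"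
proof -
  let ?M = "gauss_with_first d P" and ?T = "feature_measure d"
  interpret M: prob_space ?M by (rule prob_space_gauss_with_first[OF P(1)])
  interpret T: prob_space ?T by (rule prob_space_feature_measure)
  interpret pair_prob_space ?M ?T ..
  note [measurable_cong] = sets_gauss_with_first[OF P(2), of d]
  have [measurable]: "h \<in> borel_measurable ?T" using h by (simp add: L2_functions_def)
  have inner [measurable]: "(\<lambda>p. inner_Rd d (fst (snd p)) (fst p)) \<in> borel_measurable (?M \<Otimes>\<^sub>M ?T)"
    unfolding inner_Rd_def by measurable
  define f where "f = (\<lambda>x z. relu (inner_Rd d (fst z) x - snd z) * h z)"
  have i: "integrable (?M \<Otimes>\<^sub>M ?T) (case_prod f)"
  proof (rule Bochner_Integration.integrable_bound)
    \<comment> \<open>Every summand is a function of \<open>x\<close> times a function of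
      \<open>z\<close>; the factor 1 gives the last term this form too.\<close>
    let ?g = "\<lambda>p. (\<Sum>i<d. \<bar>fst p i\<bar> * \<bar>fst (snd p) i * h (snd p)\<bar>) + 1 * \<bar>snd (snd p) * h (snd p)\<bar>"
    show "integrable (?M \<Otimes>\<^sub>M ?T) ?g"
      using M.sigma_finite_measure_axioms T.sigma_finite_measure_axioms integrable_gauss_with_first_abs[OF P int]
        L2_feature_integrable[OF d h]
      by (intro Bochner_Integration.integrable_add Bochner_Integration.integrable_sum integrable_product_mult(1)) auto
    show "case_prod f \<in> borel_measurable (?M \<Otimes>\<^sub>M ?T)"
      unfolding f_def split_beta' by measurable
    have "\<bar>f x z\<bar> \<le> ?g (x, z)" for x z
    proof -
      have "\<bar>f x z\<bar> \<le> ((\<Sum>i<d. \<bar>fst z i\<bar> * \<bar>x i\<bar>) + \<bar>snd z\<bar>) * \<bar>h z\<bar>"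
        unfolding f_def abs_mult by (intro mult_right_mono abs_relu_inner_le) auto
      also have "\<dots> = ?g (x, z)"
        by (simp add: distrib_left sum_distrib_left abs_mult mult_ac)
      finally show ?thesis .
    qed
    then show "AE p in ?M \<Otimes>\<^sub>M ?T. norm (case_prod f p) \<le> norm (?g p)"
      by (intro always_eventually) (auto intro: order_trans[OF _ abs_ge_self])
  qed
  have ff: "feature_fun d h = (\<lambda>x. \<integral>z. f x z \<partial>?T)"
    by (simp add: feature_fun_def f_def split_beta' fun_eq_iff)
  have Rh: "(\<lambda>z. R z * h z) = (\<lambda>z. \<integral>x. f x z \<partial>?M)"
    by (simp add: R_def f_def fun_eq_iff)
  show "integrable ?M (feature_fun d h)" unfolding ff by (rule integrable_fst[OF i])
  show "integrable ?T (\<lambda>z. R z * h z)" unfolding Rh by (rule integrable_snd[OF i])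
  show "(\<integral>x. feature_fun d h x \<partial>?M) = (\<integral>z. R z * h z \<partial>?T)"
    unfolding ff Rh by (rule Fubini_integral[OF i, symmetric])
qed

text \<open>Cauchy-Schwarz in \<open>L2\<close> of the feature measure, applied as the pointwise
  inequality \<open>2 * \<bar>D * h\<bar> \<le> K * h\<^sup>2 + D\<^sup>2 / K\<close> with a
  balancing weight \<open>K\<close>.\<close>

lemma feature_discrepancy_le:
  assumes d: "d > 0" and h: "h \<in> L2_functions (feature_measure d)" and norm: "L2_norm (feature_measure d) h \<le> 2"
  shows "\<bar>\<integral>z. discrepancy d (sqrt (real d)) (fst z) (snd z) * h z \<partial>feature_measure d\<bar> \<le> 12 * exp (- real d / 16)"
proof -
  let ?T = "feature_measure d" and ?D = "\<lambda>z. discrepancy d (sqrt (real d)) (fst z) (snd z)"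
  interpret U: prob_space "unif_sphere d" by (rule prob_space_unif_sphere)
  interpret N: prob_space std_normal_distribution by (rule prob_space_std_normal)
  have h2: "integrable ?T (\<lambda>z. (h z)\<^sup>2)" using h by (simp add: L2_functions_def)
  have "sqrt (\<integral>z. (h z)\<^sup>2 \<partial>?T) \<le> 2" using norm by (simp add: L2_norm_def)
  then have h4: "(\<integral>z. (h z)\<^sup>2 \<partial>?T) \<le> 4"
    using sqrt_le_D by fastforce
  \<comment> \<open>\<open>K * K\<close> is of the same size as the bound
    \<open>12 * exp (- real d / 8)\<close> for the mean of the squared discrepancy, so both terms of
    the inequality are of order \<open>K\<close>.\<close>
  define K where "K = 4 * exp (- real d / 16)"
  have K: "K > 0" "K * K = 16 * exp (- real d / 8)"
    by (auto simp: K_def exp_add[symmetric])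
  define \<phi> where "\<phi> = (\<lambda>\<theta>::nat \<Rightarrow> real. min 1 (exp (- real d * (1 - (\<theta> 0)\<^sup>2))))"
  \<comment> \<open>Dominates \<open>(1 + \<bar>b\<bar>)\<^sup>2\<close>, and its Gaussian mean is
    4.\<close>
  let ?g = "\<lambda>b::real. 2 + 2 * b\<^sup>2"
  have [measurable]: "(\<lambda>\<theta>. \<theta> 0) \<in> borel_measurable (unif_sphere d)"
    using d measurable_component_singleton[of 0 "{..<d}" "\<lambda>_. borel :: real measure"]
    by (simp cong: measurable_cong_sets)
  have \<phi>: "integrable (unif_sphere d) \<phi>"
    unfolding \<phi>_def by (rule U.integrable_const_bound[of _ 1]) auto
  have g: "integrable std_normal_distribution ?g" "(\<integral>b. ?g b \<partial>std_normal_distribution) = 4"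
    using std_normal_second_moment N.prob_space by simp_all
  note prod = integrable_product_mult[OF sigma_finite_unif_sphere sigma_finite_std_normal \<phi> g(1), folded feature_measure_def]
  have prod_le: "(\<integral>z. \<phi> (fst z) * ?g (snd z) \<partial>?T) \<le> 12 * exp (- real d / 8)"
    unfolding prod(2) g(2) using integral_unif_sphere_exp_le[OF d] by (simp add: \<phi>_def)
  let ?B = "\<lambda>z. (K * (h z)\<^sup>2 + \<phi> (fst z) * ?g (snd z) / K) / 2"
  have iB: "integrable ?T ?B" using h2 prod(1) by simp
  have le: "AE z in ?T. \<bar>?D z * h z\<bar> \<le> ?B z"
    using AE_feature_measure[OF d]
  proof eventually_elim
    case (elim z)
    define \<theta> b where "\<theta> = fst z" and "b = snd z"
    have "\<bar>\<theta> 0\<bar> \<le> 1" using abs_component_le_norm_Rd[OF d, of \<theta>] elim by (simp add: \<theta>_def)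
    then have "real d * (1 - (\<theta> 0)\<^sup>2) \<ge> 0" by (simp add: abs_square_le_1)
    then have \<phi>\<theta>: "\<phi> \<theta> = exp (- real d * (1 - (\<theta> 0)\<^sup>2))" by (simp add: \<phi>_def min_def)
    have "\<bar>?D z\<bar> \<le> exp (- real d * (1 - (\<theta> 0)\<^sup>2) / 2) * (1 + \<bar>b\<bar>)"
      using abs_discrepancy_le[OF d, of \<theta> "sqrt (real d)" b] elim by (simp add: \<theta>_def b_def)
    then have "(?D z)\<^sup>2 \<le> (exp (- real d * (1 - (\<theta> 0)\<^sup>2) / 2) * (1 + \<bar>b\<bar>))\<^sup>2"
      by (metis abs_ge_zero power2_abs power_mono)
    also have "\<dots> = \<phi> \<theta> * (1 + \<bar>b\<bar>)\<^sup>2"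
      unfolding \<phi>\<theta> power_mult_distrib exp_double[symmetric] by simp
    also have "\<dots> \<le> \<phi> \<theta> * ?g b"
      using sum_squares_bound[of 1 "\<bar>b\<bar>"]
      by (intro mult_left_mono) (auto simp: \<phi>_def power2_sum)
    finally have D2: "(?D z)\<^sup>2 \<le> \<phi> \<theta> * ?g b" .
    have "2 * K * \<bar>?D z * h z\<bar> \<le> (K * \<bar>h z\<bar>)\<^sup>2 + \<bar>?D z\<bar>\<^sup>2"
      using sum_squares_bound[of "K * \<bar>h z\<bar>" "\<bar>?D z\<bar>"] by (simp add: abs_mult mult_ac)
    also have "\<dots> \<le> K * K * (h z)\<^sup>2 + \<phi> \<theta> * ?g b"
      using D2 by (simp add: power_mult_distrib power2_eq_square[of K])
    finally show ?case
      using K(1) unfolding \<theta>_def b_def by (simp add: field_simps)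
  qed
  have "\<bar>\<integral>z. ?D z * h z \<partial>?T\<bar> \<le> (\<integral>z. ?B z \<partial>?T)"
  proof (cases "integrable ?T (\<lambda>z. ?D z * h z)")
    case True
    then have "\<bar>\<integral>z. ?D z * h z \<partial>?T\<bar> \<le> (\<integral>z. \<bar>?D z * h z\<bar> \<partial>?T)" by (intro integral_abs_bound)
    also have "\<dots> \<le> (\<integral>z. ?B z \<partial>?T)" using True iB le by (intro integral_mono_AE) auto
    finally show ?thesis .
  next
    \<comment> \<open>The integral of a function that is not integrable is 0 by convention, so it
      suffices that the right-hand side is nonnegative.\<close>
    case False
    have "AE z in ?T. 0 \<le> ?B z" using le by eventually_elim (rule order_trans[OF abs_ge_zero])
    then show ?thesis using False by (simp add: not_integrable_integral_eq integral_nonneg_AE)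
  qed
  also have "\<dots> = (K * (\<integral>z. (h z)\<^sup>2 \<partial>?T) + (\<integral>z. \<phi> (fst z) * ?g (snd z) \<partial>?T) / K) / 2"
    using h2 prod(1) by simp
  also have "\<dots> \<le> (K * 4 + K * K / K) / 2"
    using h4 order_trans[OF prod_le, of "K * K"] K by (intro divide_right_mono add_mono mult_left_mono) auto
  also have "\<dots> \<le> 12 * exp (- real d / 16)" using K(1) by (simp add: K_def)
  finally show ?thesis .
qed

text \<open>The kernel norm is an infimum over representers. As it is at most 1, some representer
  \<open>h\<close> has norm below 2, and the discrepancy of \<open>G\<close> is the pairing of
  \<open>h\<close> with the discrepancies of the neurons.\<close>

lemma relu_rkhs_discrepancy_le:
  assumes d: "d > 0" and G: "G \<in> relu_rkhs d" "relu_rkhs_norm d G \<le> 1"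
  defines "\<mu> \<equiv> gauss_with_first d (oscillating_normal (sqrt (real d)))"
    and "\<nu> \<equiv> gauss_with_first d std_normal_distribution"
  shows "integrable \<mu> G \<and> integrable \<nu> G \<and> \<bar>(\<integral>x. G x \<partial>\<mu>) - (\<integral>x. G x \<partial>\<nu>)\<bar> \<le> 12 * exp (- real d / 16)"
proof -
  let ?T = "feature_measure d"
  have ne: "L2_norm ?T ` representers d G \<noteq> {}" using G(1) by (simp add: relu_rkhs_def)
  have "Inf (L2_norm ?T ` representers d G) < 2"
    using G(2) by (simp add: relu_rkhs_norm_def)
  from cInf_lessD[OF ne this] obtain h where hr: "h \<in> representers d G" and hn: "L2_norm ?T h \<le> 2"
    by auto
  have h: "h \<in> L2_functions ?T" and Gh: "\<And>x. x \<in> Rd d \<Longrightarrow> G x = feature_fun d h x"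
    using hr by (auto simp: representers_def)
  note O = prob_space_oscillating_normal sets_oscillating_normal integrable_oscillating_normal_abs
  have sN: "sets std_normal_distribution = sets borel" by simp
  note N = prob_space_std_normal sN integrable_std_normal_abs
  note fO = feature_fun_gauss_with_first[OF d h O[of "sqrt (real d)"], folded \<mu>_def]
  note fN = feature_fun_gauss_with_first[OF d h N, folded \<nu>_def]
  have sp: "space \<mu> = Rd d" "space \<nu> = Rd d"
    unfolding \<mu>_def \<nu>_def by (rule space_gauss_with_first; simp)+
  \<comment> \<open>\<open>G\<close> agrees with its feature function only on \<open>Rd d\<close>,
    which is the space of both measures.\<close>
  have cong: "integrable \<mu> G = integrable \<mu> (feature_fun d h)" "integrable \<nu> G = integrable \<nu> (feature_fun d h)"
    "integral\<^sup>L \<mu> G = integral\<^sup>L \<mu> (feature_fun d h)" "integral\<^sup>L \<nu> G = integral\<^sup>L \<nu> (feature_fun d h)"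
    by (intro Bochner_Integration.integrable_cong Bochner_Integration.integral_cong refl; simp add: sp Gh)+
  have "integral\<^sup>L \<mu> G - integral\<^sup>L \<nu> G
      = (\<integral>z. discrepancy d (sqrt (real d)) (fst z) (snd z) * h z \<partial>?T)"
    unfolding cong fO(3) fN(3) using fO(2) fN(2)
    by (subst Bochner_Integration.integral_diff[symmetric])
      (auto simp: discrepancy_def \<mu>_def \<nu>_def left_diff_distrib)
  then show ?thesis
    using feature_discrepancy_le[OF d h hn] fO(1) fN(1) cong by simp
qed

section \<open>A separating network\<close>

text \<open>Since \<open>pi > 3\<close>, the interval ends before \<open>pi / 2\<close>, and the
  sine increases up to there.\<close>

lemma sin_half_le:
  assumes "1 / 2 \<le> y" "y \<le> 3 / 2"
  shows "sin (1 / 2) \<le> sin (y::real)"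
  using assms pi_gt3 by (intro sin_monotone_2pi_le) auto

text \<open>For \<open>w > 0\<close> this is the tent on \<open>[0, 2 / w]\<close> with slopes 1 and
  -1 and peak \<open>1 / w\<close>. Its support lies in the positive half wave
  \<open>[0, pi / w]\<close> of \<open>sin (w * x)\<close>.\<close>

definition hat :: "real \<Rightarrow> real \<Rightarrow> real" where
  "hat w x = relu x - 2 * relu (x - 1 / w) + relu (x - 2 / w)"

text \<open>The integrand is nonnegative, so the middle half of the support suffices. It has length
  \<open>1 / w\<close>; there the tent is at least \<open>1 / (2 * w)\<close>, the sine at least
  \<open>sin (1 / 2)\<close>, and the density at least its value at \<open>3 / 2\<close>, because
  \<open>w \<ge> 1\<close> keeps \<open>x\<close> below \<open>3 / 2\<close>.\<close>

lemma integral_hat_ge: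
  fixes w :: real
  assumes w: "w \<ge> 1"
  shows "std_normal_density (3 / 2) * sin (1 / 2) / (2 * w\<^sup>2)
    \<le> (\<integral>x. std_normal_density x * (sin (w * x) * hat w x) \<partial>lborel)"
proof -
  let ?p = std_normal_density and ?I = "{1 / (2 * w) .. 3 / (2 * w)}"
  let ?k = "?p (3 / 2) * (sin (1 / 2) * (1 / (2 * w)))"
  have s: "sin (1 / 2 :: real) > 0" using pi_gt3 by (intro sin_gt_zero) auto
  have ireal: "integrable lborel (\<lambda>x. ?p x * relu (1 * x + c))" for c
    using integrable_relu_std_normal[of 1 c] by (simp add: integrable_density)
  have i: "integrable lborel (\<lambda>x. ?p x * (sin (w * x) * hat w x))"
  proof -
    have "integrable lborel (\<lambda>x. (?p x * relu (1 * x + 0) - 2 * (?p x * relu (1 * x + (- 1 / w))) + ?p x * relu (1 * x + (- 2 / w))) * sin (w * x))"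
      by (intro integrable_mult_bounded Bochner_Integration.integrable_add Bochner_Integration.integrable_diff
          integrable_mult_right ireal) auto
    then show ?thesis by (simp add: hat_def algebra_simps)
  qed
  have w0: "0 \<le> 1 / (2 * w)" using w by simp
  have len: "3 / (2 * w) - 1 / (2 * w) = 1 / w" using w by (simp add: field_simps)
  have le: "1 / (2 * w) \<le> 3 / (2 * w)" using w by (simp add: field_simps)
  have "?p (3 / 2) * sin (1 / 2) / (2 * w\<^sup>2) = ?k * measure lborel ?I"
    using le by (simp add: len power2_eq_square)
  also have "\<dots> = (\<integral>x. ?k * indicator ?I x \<partial>lborel)"
    by simp
  also have "\<dots> \<le> (\<integral>x. ?p x * (sin (w * x) * hat w x) \<partial>lborel)"
  proof (rule integral_mono)
    show "integrable lborel (\<lambda>x. ?k * indicator ?I x)"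
      by (intro integrable_mult_right integrable_real_indicator) (simp_all add: emeasure_lborel_Icc[OF le])
    fix x :: real
    \<comment> \<open>In the variable \<open>y\<close> the tent has the fixed support
      \<open>[0, 2]\<close>, up to the factor \<open>1 / w\<close>.\<close>
    define y where "y = w * x"
    have I: "x \<in> ?I \<longleftrightarrow> 1 / 2 \<le> y \<and> y \<le> 3 / 2"
      using w by (auto simp: y_def field_simps)
    have hat: "hat w x = (relu y - 2 * relu (y - 1) + relu (y - 2)) / w"
    proof -
      have "relu (x - c / w) = relu (y - c) / w" for c
        using w by (simp add: relu_def max_def y_def field_simps)
      from this[of 0] this[of 1] this[of 2] show ?thesis
        by (simp add: hat_def diff_divide_distrib add_divide_distrib)
    qed
    consider "y \<le> 0 \<or> y \<ge> 2" | "0 < y" "y < 2" "x \<notin> ?I" | "x \<in> ?I" by (metis not_le)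
    then show "?k * indicator ?I x \<le> ?p x * (sin (w * x) * hat w x)"
    proof cases
      case 1
      then have "hat w x = 0" "x \<notin> ?I" unfolding hat I by (auto simp: relu_def max_def)
      then show ?thesis by simp
    next
      case 2
      have "0 \<le> hat w x" using 2 w unfolding hat by (intro divide_nonneg_nonneg) (auto simp: relu_def max_def)
      moreover have "0 \<le> sin (w * x)"
        using 2 pi_gt3 unfolding y_def by (intro sin_ge_zero) auto
      ultimately show ?thesis using 2 by simp
    next
      case 3
      then have y: "1 / 2 \<le> y" "y \<le> 3 / 2" by (simp_all only: I)
      have "0 < x" using y w zero_less_mult_pos[of w x] unfolding y_def by simp
      then have "x \<le> y" using w mult_right_mono[of 1 w x] unfolding y_def by simp
      then have "x\<^sup>2 \<le> (3 / 2)\<^sup>2" using y \<open>0 < x\<close> by (intro power_mono) auto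
      then have "exp (- (3 / 2)\<^sup>2 / 2) \<le> exp (- x\<^sup>2 / 2)" by (subst exp_le_cancel_iff) simp
      then have p: "?p (3 / 2) \<le> ?p x"
        unfolding std_normal_density_def by (intro mult_left_mono) auto
      have "(1 / 2) / w \<le> hat w x"
        unfolding hat using y w by (intro divide_right_mono) (auto simp: relu_def max_def)
      then have t: "1 / (2 * w) \<le> hat w x" by simp
      have "sin (1 / 2) \<le> sin (w * x)" using sin_half_le[OF y] by (simp add: y_def)
      then have "sin (1 / 2) * (1 / (2 * w)) \<le> sin (w * x) * hat w x"
        using s w0 t by (intro mult_mono) linarith+
      then have "?k \<le> ?p x * (sin (w * x) * hat w x)"
        by (rule mult_mono[OF p]) (use s w in auto)
      then show ?thesis using 3 by simp
    qed
  qed (rule i)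
  finally show ?thesis .
qed

text \<open>All other coefficients vanish, so the outer integral is over a constant and nothing
  smooths the sine.\<close>

lemma discrepancy_first_axis:
  assumes d: "d > 0"
  shows "discrepancy d w (\<lambda>i\<in>{..<d}. if i = 0 then 1 else 0) b
    = (\<integral>x. std_normal_density x * (sin (w * x) * relu (x - b)) \<partial>lborel)"
proof -
  interpret prob_space "Pi\<^sub>M {1..<d} (\<lambda>_. std_normal_distribution)"
    by (intro prob_space_PiM prob_space_std_normal)
  show ?thesis unfolding discrepancy_eq[OF d] using d prob_space by simp
qed

text \<open>The network is a quarter of the tent along the first axis, at the frequency
  \<open>sqrt d\<close> of the oscillation. Its discrepancy is of order
  \<open>1 / om\<^sup>2 = 1 / d\<close>.\<close>

lemma relu_network_discrepancy_ge:
  fixes d :: nat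
  assumes d: "d > 0"
  defines "\<mu> \<equiv> gauss_with_first d (oscillating_normal (sqrt (real d)))"
    and "\<nu> \<equiv> gauss_with_first d std_normal_distribution"
  shows "\<exists>(m::nat) \<theta> b w w0. (\<forall>i<m. \<theta> i \<in> Rd d) \<and> path_norm d m \<theta> w = 1 \<and>
    integrable \<mu> (relu_network d m \<theta> b w w0) \<and> integrable \<nu> (relu_network d m \<theta> b w w0) \<and>
    \<bar>(\<integral>x. relu_network d m \<theta> b w w0 x \<partial>\<mu>) - (\<integral>x. relu_network d m \<theta> b w w0 x \<partial>\<nu>)\<bar>
      \<ge> std_normal_density (3 / 2) * sin (1 / 2) / 8 / real d"
proof -
  define e where "e = (\<lambda>i\<in>{..<d}. if i = 0 then 1 else 0 :: real)"
  define om where "om = sqrt (real d)"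
  have om: "om \<ge> 1" "om\<^sup>2 = real d" using d by (auto simp: om_def)
  define b where "b = (\<lambda>i::nat. real i / om)"
  \<comment> \<open>The weights 1, -2, 1 of the tent divided by 4, so that with unit directions the
    path-norm is 1.\<close>
  define w where "w = (\<lambda>i::nat. if i = 1 then - 1 / 2 else 1 / 4 :: real)"
  let ?F = "relu_network d 3 (\<lambda>_. e) b w 0"
  have three: "(\<Sum>i<3. f i) = f 0 + f 1 + f 2" for f :: "nat \<Rightarrow> real"
    by (simp add: eval_nat_numeral)
  have e_norm: "norm_Rd d e = 1"
  proof -
    have "(\<Sum>i<d. (e i)\<^sup>2) = (\<Sum>i<d. if i = 0 then 1 else 0)"
      by (intro sum.cong) (auto simp: e_def)
    then show ?thesis using d by (simp add: L2_set_def)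
  qed
  note O = prob_space_oscillating_normal sets_oscillating_normal integrable_oscillating_normal_abs
  have sN: "sets std_normal_distribution = sets borel" by simp
  note N = prob_space_std_normal sN integrable_std_normal_abs
  have i\<mu>: "integrable \<mu> (\<lambda>x. relu (inner_Rd d e x - c))"
    and i\<nu>: "integrable \<nu> (\<lambda>x. relu (inner_Rd d e x - c))" for c
    unfolding \<mu>_def \<nu>_def by (rule integrable_relu_gauss_with_first O N)+
  have F: "?F = (\<lambda>x. \<Sum>i<3. w i * relu (inner_Rd d e x - b i))"
    by (simp add: relu_network_def fun_eq_iff)
  have I: "integrable \<mu> ?F" "integrable \<nu> ?F"
    unfolding F using i\<mu> i\<nu> by auto
  have ireal: "integrable lborel (\<lambda>x. std_normal_density x * (sin (om * x) * relu (x - c)))" for c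
  proof -
    have "integrable lborel (\<lambda>x. std_normal_density x * relu (x - c))"
      using integrable_relu_std_normal[of 1 "- c"] by (simp add: integrable_density)
    from integrable_mult_bounded[OF this, of "\<lambda>x. sin (om * x)"] show ?thesis by (simp add: mult_ac)
  qed
  have "integral\<^sup>L \<mu> ?F - integral\<^sup>L \<nu> ?F = (\<Sum>i<3. w i * discrepancy d om e (b i))"
    unfolding F discrepancy_def om_def \<mu>_def[symmetric] \<nu>_def[symmetric] using i\<mu> i\<nu>
    by (simp add: right_diff_distrib sum_subtractf)
  also have "\<dots> = (\<Sum>i<3. \<integral>x. w i * (std_normal_density x * (sin (om * x) * relu (x - b i))) \<partial>lborel)"
    unfolding e_def discrepancy_first_axis[OF d] by simp
  also have "\<dots> = (\<integral>x. (\<Sum>i<3. w i * (std_normal_density x * (sin (om * x) * relu (x - b i)))) \<partial>lborel)"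
    using ireal by (intro Bochner_Integration.integral_sum[symmetric] integrable_mult_right) auto
  also have "\<dots> = (\<integral>x. 1 / 4 * (std_normal_density x * (sin (om * x) * hat om x)) \<partial>lborel)"
    by (intro Bochner_Integration.integral_cong refl) (simp add: three hat_def w_def b_def algebra_simps)
  also have "\<dots> = 1 / 4 * (\<integral>x. std_normal_density x * (sin (om * x) * hat om x) \<partial>lborel)"
    by (rule integral_mult_right_zero)
  finally have "integral\<^sup>L \<mu> ?F - integral\<^sup>L \<nu> ?F \<ge> std_normal_density (3 / 2) * sin (1 / 2) / 8 / real d"
    using integral_hat_ge[OF om(1)] om(2) by simp
  moreover have "path_norm d 3 (\<lambda>_. e) w = 1"
    unfolding path_norm_def three e_norm by (simp add: w_def)
  moreover have "e \<in> Rd d" by (simp add: e_def)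
  ultimately show ?thesis
    using I by - (rule exI[of _ 3], rule exI[of _ "\<lambda>_. e"], rule exI[of _ b], rule exI[of _ w],
      rule exI[of _ 0], auto)
qed

section \<open>Constants of the final estimate\<close>

lemma exp_dim_le:
  assumes "d \<ge> 1"
  shows "exp (- real d / 16) \<le> real d * exp (- ((sqrt (real d) - 1)\<^sup>2 / 16))"
proof -
  have "1 \<le> sqrt (real d)" using assms by simp
  moreover have "(sqrt (real d) - 1)\<^sup>2 = real d - 2 * sqrt (real d) + 1" by (simp add: power2_diff)
  ultimately have "(sqrt (real d) - 1)\<^sup>2 \<le> real d" by linarith
  then have "1 * exp (- real d / 16) \<le> real d * exp (- ((sqrt (real d) - 1)\<^sup>2 / 16))"
    using assms by (intro mult_mono) auto
  then show ?thesis by simp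
qed

theorem theorem2:
  shows "\<exists>c C :: real. c > 0 \<and> C > 0 \<and>
    (\<forall>d::nat. d \<ge> 2 \<longrightarrow>
      (\<exists>\<mu> \<nu> :: (nat \<Rightarrow> real) measure.
        prob_space \<mu> \<and> sets \<mu> = sets (borel_Rd d) \<and>
        prob_space \<nu> \<and> sets \<nu> = sets (borel_Rd d) \<and>
        (\<exists>(m::nat) \<theta> b w w0.
          (\<forall>i<m. \<theta> i \<in> Rd d) \<and>
          path_norm d m \<theta> w = 1 \<and>
          integrable \<mu> (relu_network d m \<theta> b w w0) \<and>
          integrable \<nu> (relu_network d m \<theta> b w w0) \<and>
          \<bar>(\<integral>x. relu_network d m \<theta> b w w0 x \<partial>\<mu>) - (\<integral>x. relu_network d m \<theta> b w w0 x \<partial>\<nu>)\<bar>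
            \<ge> c / (real d * ln (real d))) \<and>
        (\<forall>G \<in> relu_rkhs d. relu_rkhs_norm d G \<le> 1 \<longrightarrow>
          integrable \<mu> G \<and> integrable \<nu> G \<and>
          \<bar>(\<integral>x. G x \<partial>\<mu>) - (\<integral>x. G x \<partial>\<nu>)\<bar>
            \<le> C * real d * exp (- ((sqrt (real d) - 1)\<^sup>2 / 16)))))"
proof -
  define \<kappa> :: real where "\<kappa> = std_normal_density (3 / 2) * sin (1 / 2) / 8"
  have "sin (1 / 2 :: real) > 0" using pi_gt3 by (intro sin_gt_zero) auto
  then have \<kappa>: "\<kappa> > 0" unfolding \<kappa>_def by (simp add: normal_density_pos)
  \<comment> \<open>The network achieves \<open>\<kappa> / d\<close>. As
    \<open>ln d \<ge> ln 2\<close> for \<open>d \<ge> 2\<close>, the factor \<open>ln 2\<close> in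
    the constant absorbs the logarithm.\<close>
  have lower: "\<kappa> * ln 2 / (real d * ln (real d)) \<le> \<kappa> / real d" if "d \<ge> 2" for d
  proof -
    have "ln 2 \<le> ln (real d)" "0 < ln (real d)" using that by auto
    then have "\<kappa> / real d * (ln 2 / ln (real d)) \<le> \<kappa> / real d * 1"
      using \<kappa> by (intro mult_left_mono) auto
    then show ?thesis by simp
  qed
  show ?thesis
  proof (rule exI[of _ "\<kappa> * ln 2"], rule exI[of _ 12], intro conjI allI impI)
    fix d :: nat assume d: "d \<ge> 2"
    define \<mu> where "\<mu> = gauss_with_first d (oscillating_normal (sqrt (real d)))"
    define \<nu> where "\<nu> = gauss_with_first d std_normal_distribution"
    have d0: "d > 0" using d by simp
    note network = relu_network_discrepancy_ge[OF d0, folded \<mu>_def \<nu>_def \<kappa>_def]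
    note rkhs = relu_rkhs_discrepancy_le[OF d0, folded \<mu>_def \<nu>_def]
    show "\<exists>\<mu> \<nu> :: (nat \<Rightarrow> real) measure.
        prob_space \<mu> \<and> sets \<mu> = sets (borel_Rd d) \<and>
        prob_space \<nu> \<and> sets \<nu> = sets (borel_Rd d) \<and>
        (\<exists>(m::nat) \<theta> b w w0.
          (\<forall>i<m. \<theta> i \<in> Rd d) \<and>
          path_norm d m \<theta> w = 1 \<and>
          integrable \<mu> (relu_network d m \<theta> b w w0) \<and>
          integrable \<nu> (relu_network d m \<theta> b w w0) \<and>
          \<bar>(\<integral>x. relu_network d m \<theta> b w w0 x \<partial>\<mu>) - (\<integral>x. relu_network d m \<theta> b w w0 x \<partial>\<nu>)\<bar>
            \<ge> \<kappa> * ln 2 / (real d * ln (real d))) \<and>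
        (\<forall>G \<in> relu_rkhs d. relu_rkhs_norm d G \<le> 1 \<longrightarrow>
          integrable \<mu> G \<and> integrable \<nu> G \<and>
          \<bar>(\<integral>x. G x \<partial>\<mu>) - (\<integral>x. G x \<partial>\<nu>)\<bar>
            \<le> 12 * real d * exp (- ((sqrt (real d) - 1)\<^sup>2 / 16)))"
    proof (rule exI[of _ \<mu>], rule exI[of _ \<nu>], intro conjI ballI impI)
      show "prob_space \<mu>" "prob_space \<nu>" unfolding \<mu>_def \<nu>_def
        by (intro prob_space_gauss_with_first prob_space_oscillating_normal prob_space_std_normal)+
      show "sets \<mu> = sets (borel_Rd d)" "sets \<nu> = sets (borel_Rd d)" unfolding \<mu>_def \<nu>_def
        by (rule sets_gauss_with_first; simp)+
      show "\<exists>(m::nat) \<theta> b w w0. (\<forall>i<m. \<theta> i \<in> Rd d) \<and> path_norm d m \<theta> w = 1 \<and>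
          integrable \<mu> (relu_network d m \<theta> b w w0) \<and> integrable \<nu> (relu_network d m \<theta> b w w0) \<and>
          \<bar>(\<integral>x. relu_network d m \<theta> b w w0 x \<partial>\<mu>) - (\<integral>x. relu_network d m \<theta> b w w0 x \<partial>\<nu>)\<bar>
            \<ge> \<kappa> * ln 2 / (real d * ln (real d))"
        using network lower[OF d] by (meson order_trans)
      fix G assume "G \<in> relu_rkhs d" "relu_rkhs_norm d G \<le> 1"
      note G = rkhs[OF this]
      then show "integrable \<mu> G" "integrable \<nu> G" by auto
      show "\<bar>(\<integral>x. G x \<partial>\<mu>) - (\<integral>x. G x \<partial>\<nu>)\<bar> \<le> 12 * real d * exp (- ((sqrt (real d) - 1)\<^sup>2 / 16))"
        using G exp_dim_le[of d] d by simp
    qed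
  qed (use \<kappa> in auto)
qed

end
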